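(* Let $A$ be an algebra of Jordan type half over a field $\mathbb{F}$ of characteristic not $2$, let $a,b\in A$ be primitive axes of Jordan type half, and let $J=\langle\langle a,b\rangle\rangle$ be the subalgebra of $A$ generated by $a$ and $b$. If $(a,b)\notin\{0,\frac14,1\}$, then $J$ is solid; that is, every idempotent $c\in J$ with $c\neq 0$ and $c\neq 1_J$ is a primitive axis of Jordan type half in $A$.
   Context: All algebras are commutative but not necessarily associative. For an element $x$ of an algebra $A$ and $\lambda\in\mathbb{F}$ write $A_\lambda(x)=\{u\in A: xu=\lambda u\}$. A primitive axis of Jordan type half in $A$ is an element $x\neq 0$ with $x^2=x$, $A=A_1(x)\oplus A_0(x)\oplus A_{1/2}(x)$, $A_1(x)=\mathbb{F}x$, and satisfying the fusion rules $A_1(x)A_1(x)\subseteq A_1(x)$, $A_1(x)A_0(x)=0$, $A_0(x)A_0(x)\subseteq A_0(x)$, $A_1(x)A_{1/2}(x)\subseteq A_{1/2}(x)$, $A_0(x)A_{1/2}(x)\subseteq A_{1/2}(x)$, $A_{1/2}(x)A_{1/2}(x)\subseteq A_1(x)\oplus A_0(x)$. An algebra of Jordan type half is a commutative algebra generated by a set of primitive axes of Jordan type half. Every such algebra admits a unique bilinear form $(\cdot,\cdot)$ (the Frobenius form) satisfying $(uv,w)=(u,vw)$ for all $u,v,w$ and $(x,x)=1$ for every primitive axis $x$; $(a,b)$ denotes this form. A subalgebra $J=\langle\langle a,b\rangle\rangle$ generated by two primitive axes is called solid if every idempotent $c\in J$ with $c\neq 0$ and $c\neq 1_J$ (where $1_J$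 is the identity element of $J$, when $J$ has one) is a primitive axis of Jordan type half in $A$. (When $(a,b)\neq 1$, $J$ has an identity element.) *)

theory Defs
  imports Complex_Main
begin

text \<open>An algebra over the field 'k: the additive group 'a, a scalar multiplication
  sc making 'a a 'k-vector space, and a product mu that is commutative and bilinear
  (linear in the second argument; with commutativity, bilinear).
  No associativity is assumed.\<close>

definition comm_algebra :: "('k::field \<Rightarrow> 'a::ab_group_add \<Rightarrow> 'a) \<Rightarrow> ('a \<Rightarrow> 'a \<Rightarrow> 'a) \<Rightarrow> bool" where
  "comm_algebra sc mu \<longleftrightarrow> vector_space sc \<and> (\<forall>x y. mu x y = mu y x) \<and>
     (\<forall>x. Vector_Spaces.linear sc sc (mu x))"

definition eigsp :: "('k::field \<Rightarrow> 'a::ab_group_add \<Rightarrow> 'a) \<Rightarrow> ('a \<Rightarrow> 'a \<Rightarrow> 'a) \<Rightarrow> 'a \<Rightarrow> 'k \<Rightarrow> 'a set" where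
  "eigsp sc mu x l = {u. mu x u = sc l u}"

definition prim_axis_half :: "('k::field \<Rightarrow> 'a::ab_group_add \<Rightarrow> 'a) \<Rightarrow> ('a \<Rightarrow> 'a \<Rightarrow> 'a) \<Rightarrow> 'a \<Rightarrow> bool" where
  "prim_axis_half sc mu x \<longleftrightarrow>
     (let A1 = eigsp sc mu x 1; A0 = eigsp sc mu x 0; Ah = eigsp sc mu x (1/2) in
       x \<noteq> 0 \<and> mu x x = x \<and>
       (\<forall>u. \<exists>u1 u0 uh. u1 \<in> A1 \<and> u0 \<in> A0 \<and> uh \<in> Ah \<and> u = u1 + u0 + uh) \<and>
       A1 = range (\<lambda>c. sc c x) \<and>
       (\<forall>u\<in>A1. \<forall>v\<in>A1. mu u v \<in> A1) \<and>
       (\<forall>u\<in>A1. \<forall>v\<in>A0. mu u v = 0) \<and>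
       (\<forall>u\<in>A0. \<forall>v\<in>A0. mu u v \<in> A0) \<and>
       (\<forall>u\<in>A1. \<forall>v\<in>Ah. mu u v \<in> Ah) \<and>
       (\<forall>u\<in>A0. \<forall>v\<in>Ah. mu u v \<in> Ah) \<and>
       (\<forall>u\<in>Ah. \<forall>v\<in>Ah. \<exists>w1 w0. w1 \<in> A1 \<and> w0 \<in> A0 \<and> mu u v = w1 + w0))"

inductive_set gen_subalg :: "('k::field \<Rightarrow> 'a::ab_group_add \<Rightarrow> 'a) \<Rightarrow> ('a \<Rightarrow> 'a \<Rightarrow> 'a) \<Rightarrow> 'a set \<Rightarrow> 'a set"
  for sc :: "'k::field \<Rightarrow> 'a::ab_group_add \<Rightarrow> 'a" and mu :: "'a \<Rightarrow> 'a \<Rightarrow> 'a" and X :: "'a set" where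
  gen_base: "x \<in> X \<Longrightarrow> x \<in> gen_subalg sc mu X"
| gen_zero: "0 \<in> gen_subalg sc mu X"
| gen_add: "u \<in> gen_subalg sc mu X \<Longrightarrow> v \<in> gen_subalg sc mu X \<Longrightarrow> u + v \<in> gen_subalg sc mu X"
| gen_scale: "u \<in> gen_subalg sc mu X \<Longrightarrow> sc c u \<in> gen_subalg sc mu X"
| gen_mult: "u \<in> gen_subalg sc mu X \<Longrightarrow> v \<in> gen_subalg sc mu X \<Longrightarrow> mu u v \<in> gen_subalg sc mu X"

definition jordan_type_half_algebra :: "('k::field \<Rightarrow> 'a::ab_group_add \<Rightarrow> 'a) \<Rightarrow> ('a \<Rightarrow> 'a \<Rightarrow> 'a) \<Rightarrow> bool" where
  "jordan_type_half_algebra sc mu \<longleftrightarrow> comm_algebra sc mu \<and>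
     (\<exists>X. (\<forall>x\<in>X. prim_axis_half sc mu x) \<and> gen_subalg sc mu X = UNIV)"

definition frobenius_form :: "('k::field \<Rightarrow> 'a::ab_group_add \<Rightarrow> 'a) \<Rightarrow> ('a \<Rightarrow> 'a \<Rightarrow> 'a) \<Rightarrow> ('a \<Rightarrow> 'a \<Rightarrow> 'k) \<Rightarrow> bool" where
  "frobenius_form sc mu B \<longleftrightarrow>
     (\<forall>u. Vector_Spaces.linear sc (*) (B u)) \<and>
     (\<forall>w. Vector_Spaces.linear sc (*) (\<lambda>u. B u w)) \<and>
     (\<forall>u v w. B (mu u v) w = B u (mu v w)) \<and>
     (\<forall>x. prim_axis_half sc mu x \<longrightarrow> B x x = 1)"

definition is_identity_of :: "('a \<Rightarrow> 'a \<Rightarrow> 'a) \<Rightarrow> 'a set \<Rightarrow> 'a \<Rightarrow> bool" where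
  "is_identity_of mu J e \<longleftrightarrow> e \<in> J \<and> (\<forall>u\<in>J. mu e u = u)"

definition solid :: "('k::field \<Rightarrow> 'a::ab_group_add \<Rightarrow> 'a) \<Rightarrow> ('a \<Rightarrow> 'a \<Rightarrow> 'a) \<Rightarrow> 'a \<Rightarrow> 'a \<Rightarrow> bool" where
  "solid sc mu a b \<longleftrightarrow>
     (\<forall>c\<in>gen_subalg sc mu {a, b}. mu c c = c \<and> c \<noteq> 0 \<and>
        \<not> is_identity_of mu (gen_subalg sc mu {a, b}) c \<longrightarrow> prim_axis_half sc mu c)"

end

theory Submission
  imports Defs
begin

text \<open>
  With the help of the form, being a primitive axis of Jordan type half becomes two identities: a
  quadratic equation for the multiplication by \<open>x\<close>, and multiplicativity of the involution \<open>\<tau>\<close>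
  of \<open>x\<close>. The identities of \<open>a\<close> and \<open>b\<close> determine how \<open>J\<close> acts: its identity \<open>e\<close> is diagonalizable
  with eigenvalues 1, 0, 1/2, and the trace-zero plane of \<open>J\<close> kills the complement of \<open>J\<close> in the first
  eigenspace and all of the second, and acts on the third as a Clifford module. Then the products of
  the Peirce components are governed by relations which are linear in vectors of the plane, hence
  extend from \<open>a\<close> and \<open>b\<close> to every idempotent. The only obstruction is the component in the
  1/2-eigenspace of a product of two of its elements: it commutes with the rotation \<open>\<tau>\<^sub>a \<tau>\<^sub>b\<close>, and comparing
  eigenvalues shows that it vanishes unless the rotation has order 3, i.e. unless \<open>(a, b) = 1/4\<close>.
\<close>

text \<open>Each excluded value of the form enters as a factor to be cancelled. The coefficient of
  \<open>e\<close> divides by \<open>\<alpha> - 1\<close>. The Gram determinant of \<open>u\<close>,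
  \<open>w\<close> is \<open>16 * \<alpha> * (1 - \<alpha>)\<close>, so the splitting of the algebra
  into J and its orthogonal complement needs \<open>\<alpha>\<close> to avoid both 0 and 1. The
  factor \<open>4 * \<alpha> - 1\<close> appears once, in \<open>q_rot_left\<close>. A recurring
  obstacle is that \<open>e\<close> is not an axis: no involution belongs to it, and commuting with
  \<open>a\<close> and \<open>b\<close> does not formally give commuting with \<open>e\<close>. The
  remedy is that on the complement of J the square of the multiplication by \<open>a - b\<close> is
  \<open>(1 - \<alpha>) *s q\<close>, so the actions of the two axes alone already detect the
  1/2-component for \<open>e\<close>. No dimension is assumed finite. Vector identities are tested
  on linear functionals, which turns them into polynomial identities over the field, where Groebner
  bases apply.\<close>

lemma functional_eqI:
  fixes sc :: "'k::field \<Rightarrow> 'a::ab_group_add \<Rightarrow> 'a"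
  assumes vs: "vector_space sc"
    and eq: "\<And>f. Vector_Spaces.linear sc (*) f \<Longrightarrow> f x = f y"
  shows "x = y"
proof (rule ccontr)
  assume "x \<noteq> y"
  interpret vector_space sc by (rule vs)
  interpret k: vector_space "(*) :: 'k \<Rightarrow> 'k \<Rightarrow> 'k"
    by unfold_locales (simp_all add: algebra_simps)
  interpret vp: vector_space_pair sc "(*) :: 'k \<Rightarrow> 'k \<Rightarrow> 'k" ..
  from \<open>x \<noteq> y\<close> have "independent {x - y}"
    by simp
  then obtain g where g: "Vector_Spaces.linear sc (*) g" "g (x - y) = 1"
    using vp.linear_independent_extend[of "{x - y}" "\<lambda>_. 1"] by auto
  moreover have "g (x - y) = g x - g y"
    using g(1) by (rule vp.linear_diff)
  ultimately show False using eq[OF g(1)] by simp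
qed

lemma eq_diff_0: "x = y \<Longrightarrow> f x - f y = (0 :: 'k::ab_group_add)"
  by simp

section \<open>Algebras with a Frobenius form, and primitive axes described by identities\<close>

locale form_algebra =
  fixes sc :: "'k::field \<Rightarrow> 'a::ab_group_add \<Rightarrow> 'a" (infixr "*s" 75)
    and mu :: "'a \<Rightarrow> 'a \<Rightarrow> 'a" (infixl "\<cdot>" 70)
    and B :: "'a \<Rightarrow> 'a \<Rightarrow> 'k"
  assumes two_neq_0: "(2::'k) \<noteq> 0"
    and alg: "comm_algebra sc mu"
    and form: "frobenius_form sc mu B"
begin

sublocale vector_space sc
  using alg by (simp add: comm_algebra_def)

sublocale scalars: vector_space "(*) :: 'k \<Rightarrow> 'k \<Rightarrow> 'k"
  by unfold_locales (simp_all add: algebra_simps)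

sublocale functionals: vector_space_pair sc "(*) :: 'k \<Rightarrow> 'k \<Rightarrow> 'k" ..

abbreviation functional :: "('a \<Rightarrow> 'k) \<Rightarrow> bool" where
  "functional \<equiv> Vector_Spaces.linear sc (*)"

lemmas vec_eqI = functional_eqI[OF vector_space_axioms]

lemma functional_simps:
  assumes "functional f"
  shows "f (x + y) = f x + f y" "f (x - y) = f x - f y" "f (- x) = - f x"
    "f (c *s x) = c * f x" "f 0 = 0"
  using assms functionals.linear_add functionals.linear_diff functionals.linear_neg
    functionals.linear_scale functionals.linear_0 by blast+

text \<open>The linearity of \<open>f\<close> is spelled out so that the simplifier can use it as local rewrite rules.\<close>

lemma vec_eqI':
  assumes "\<And>f. (\<And>x y. f (x + y) = f x + f y) \<Longrightarrow> (\<And>x y. f (x - y) = f x - f y) \<Longrightarrow>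
    (\<And>x. f (- x) = - f x) \<Longrightarrow> (\<And>c x. f (c *s x) = c * f x) \<Longrightarrow> f 0 = 0 \<Longrightarrow> f x = f y"
  shows "x = y"
  by (rule vec_eqI) (rule assms; rule functional_simps)

lemma commute: "x \<cdot> y = y \<cdot> x"
  using alg by (simp add: comm_algebra_def)

lemma linear_mu: "Vector_Spaces.linear sc sc (mu x)"
  using alg by (simp add: comm_algebra_def)

lemma mu_right [simp]:
  "x \<cdot> (y + z) = x \<cdot> y + x \<cdot> z" "x \<cdot> (y - z) = x \<cdot> y - x \<cdot> z" "x \<cdot> (- y) = - (x \<cdot> y)"
  "x \<cdot> (c *s y) = c *s (x \<cdot> y)" "x \<cdot> 0 = 0"
proof -
  interpret l: Vector_Spaces.linear sc sc "mu x" by (rule linear_mu)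
  show "x \<cdot> (y + z) = x \<cdot> y + x \<cdot> z" "x \<cdot> (y - z) = x \<cdot> y - x \<cdot> z" "x \<cdot> (- y) = - (x \<cdot> y)"
    "x \<cdot> (c *s y) = c *s (x \<cdot> y)" "x \<cdot> 0 = 0"
    by (rule l.add l.diff l.neg l.scale l.zero)+
qed

lemma mu_left [simp]:
  "(y + z) \<cdot> x = y \<cdot> x + z \<cdot> x" "(y - z) \<cdot> x = y \<cdot> x - z \<cdot> x" "(- y) \<cdot> x = - (y \<cdot> x)"
  "(c *s y) \<cdot> x = c *s (y \<cdot> x)" "0 \<cdot> x = 0"
  using mu_right by (simp_all add: commute[of _ x])

lemma form_right [simp]:
  "B x (y + z) = B x y + B x z" "B x (y - z) = B x y - B x z" "B x (- y) = - B x y"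
  "B x (c *s y) = c * B x y" "B x 0 = 0"
  using form by (auto simp: frobenius_form_def functional_simps)

lemma form_left [simp]:
  "B (y + z) x = B y x + B z x" "B (y - z) x = B y x - B z x" "B (- y) x = - B y x"
  "B (c *s y) x = c * B y x" "B 0 x = 0"
  using form functional_simps[of "\<lambda>u. B u x"] by (auto simp: frobenius_form_def)

lemma form_assoc: "B (x \<cdot> y) z = B x (y \<cdot> z)"
  using form by (simp add: frobenius_form_def)

text \<open>The hypotheses often yield an identity only after multiplication by 2, 4 or
  \<open>1 - \<alpha>\<close>; stating the multiple keeps division out of the ring
  computation.\<close>

lemma vec_eqI_scaled:
  assumes "k \<noteq> 0" "\<And>f. functional f \<Longrightarrow> k * f x = k * f y"
  shows "x = y"
  using assms by (intro vec_eqI) simp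

lemma four_neq_0 [simp]: "(4::'k) \<noteq> 0"
proof -
  have "(4::'k) = 2 * 2" by simp
  then show ?thesis using two_neq_0 by (metis mult_eq_0_iff)
qed

text \<open>For an axis \<open>x\<close>, an element \<open>s *s x + y0 + yh\<close> has
  \<open>B x y = s\<close> and product \<open>s *s x\<close> plus half of \<open>yh\<close> with
  \<open>x\<close>, so this formula returns \<open>s *s x + y0 - yh\<close> without naming the
  components.\<close>

definition refl :: "'a \<Rightarrow> 'a \<Rightarrow> 'a" where
  "refl x y = y - 4 *s (x \<cdot> y) + (4 * B x y) *s x"

lemma refl_linear [simp]:
  "refl x (y + z) = refl x y + refl x z" "refl x (y - z) = refl x y - refl x z"
  "refl x (- y) = - refl x y" "refl x (c *s y) = c *s refl x y"
proof -
  show *: "refl x (y + z) = refl x y + refl x z" for y z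
    by (rule vec_eqI') (simp add: refl_def ring_distribs)
  show **: "refl x (c *s y) = c *s refl x y" for y c
    by (rule vec_eqI') (simp add: refl_def ring_distribs)
  show "refl x (- y) = - refl x y" for y
    using **[of "-1" y] by simp
  then show "refl x (y - z) = refl x y - refl x z"
    using *[of y "- z"] by simp
qed

text \<open>Given the eigenvalue condition and the form, the fusion rules amount to multiplicativity of the
  Miyamoto involution \<open>refl x\<close>. This leaves identities of low degree in \<open>x\<close>.\<close>

definition axis_identities :: "'a \<Rightarrow> bool" where
  "axis_identities x \<longleftrightarrow> x \<noteq> 0 \<and> x \<cdot> x = x \<and>
    (\<forall>y. 2 *s (x \<cdot> (x \<cdot> y)) = x \<cdot> y + B x y *s x) \<and>
    (\<forall>y z. refl x (y \<cdot> z) = refl x y \<cdot> refl x z)"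

text \<open>Associativity of the form makes the 0- and 1/2-eigenspaces orthogonal to
  \<open>x\<close> in both arguments. Hence \<open>B x y\<close> is the coefficient of
  \<open>x\<close> in \<open>y\<close>; symmetry, which is not part of
  \<open>frobenius_form\<close>, follows when one argument is an axis. The quadratic identity holds
  because t(2t - 1) vanishes at 0 and 1/2 and is 1 at 1; multiplicativity is the grading of the
  fusion rules by the sign of \<open>refl x\<close>.\<close>

lemma prim_axis_halfD:
  assumes x: "prim_axis_half sc mu x"
  shows "axis_identities x" "B x y = B y x"
proof -
  define h where "h = (1 / 2 :: 'k)"
  have h: "2 * h = 1" using two_neq_0 by (simp add: h_def)
  then have h4: "4 * h = 2" by algebra
  note ax = x[unfolded prim_axis_half_def Let_def eigsp_def mem_Collect_eq, folded h_def]
  have idem: "x \<cdot> x = x" and nz: "x \<noteq> 0" using ax by auto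
  have Bxx: "B x x = 1" using form x by (auto simp: frobenius_form_def)
  have dec: "\<exists>s y0 yh. y = s *s x + y0 + yh \<and> x \<cdot> y0 = 0 \<and> x \<cdot> yh = h *s yh" for y
  proof -
    obtain y1 y0 yh where y: "x \<cdot> y1 = 1 *s y1" "x \<cdot> y0 = 0 *s y0" "x \<cdot> yh = h *s yh" "y = y1 + y0 + yh"
      using ax by blast
    moreover from y(1) have "y1 \<in> range (\<lambda>c. c *s x)" using ax by blast
    ultimately show ?thesis by auto
  qed
  have B0: "B x y = 0" "B y x = 0" if "x \<cdot> y = 0" for y
    using that form_assoc[of x x y] form_assoc[of y x x] idem commute[of x y] by auto
  have Bh: "B x y = 0" "B y x = 0" if "x \<cdot> y = h *s y" for y
  proof -
    have "B x y = h * B x y" "B y x = h * B y x"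
      by (metis form_assoc form_right(4) idem that) (metis commute form_assoc form_left(4) idem that)
    then show "B x y = 0" "B y x = 0" using h by algebra+
  qed
  show "B x y = B y x"
  proof -
    obtain s y0 yh where y: "y = s *s x + y0 + yh" "x \<cdot> y0 = 0" "x \<cdot> yh = h *s yh" using dec by blast
    show ?thesis by (simp add: y(1) B0 Bh y(2,3))
  qed
  have even1: "refl x (s *s x) = s *s x" for s
    by (rule vec_eqI') (simp add: refl_def idem Bxx)
  have even0: "refl x y = y" if "x \<cdot> y = 0" for y
    using that B0 by (simp add: refl_def)
  have odd: "refl x y = - y" if "x \<cdot> y = h *s y" for y
  proof (rule vec_eqI)
    fix f assume f: "functional f"
    show "f (refl x y) = f (- y)"
      using that Bh[OF that] h h4 by (simp add: refl_def functional_simps[OF f])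
  qed
  have "2 *s (x \<cdot> (x \<cdot> y)) = x \<cdot> y + B x y *s x" for y
  proof -
    obtain s y0 yh where y: "y = s *s x + y0 + yh" "x \<cdot> y0 = 0" "x \<cdot> yh = h *s yh" using dec by blast
    show ?thesis
    proof (rule vec_eqI)
      fix f assume f: "functional f"
      show "f (2 *s (x \<cdot> (x \<cdot> y))) = f (x \<cdot> y + B x y *s x)"
        using h by (simp add: functional_simps[OF f] y idem Bxx B0 Bh; algebra)
    qed
  qed
  moreover have "refl x (y \<cdot> z) = refl x y \<cdot> refl x z" for y z
  proof -
    obtain s y0 yh where y: "y = s *s x + y0 + yh" "x \<cdot> y0 = 0" "x \<cdot> yh = h *s yh" using dec by blast
    obtain t z0 zh where z: "z = t *s x + z0 + zh" "x \<cdot> z0 = 0" "x \<cdot> zh = h *s zh" using dec by blast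
    have y0z0: "refl x (y0 \<cdot> z0) = y0 \<cdot> z0"
      using ax y z even0 by auto
    have yhzh: "refl x (yh \<cdot> zh) = yh \<cdot> zh"
    proof -
      obtain w1 w0 where w: "yh \<cdot> zh = w1 + w0" "x \<cdot> w1 = 1 *s w1" "x \<cdot> w0 = 0 *s w0"
        using ax y z by blast
      moreover from w(2) obtain r where "w1 = r *s x" using ax by blast
      ultimately show ?thesis using even1[of 1] by (simp add: even0)
    qed
    have y0zh: "refl x (y0 \<cdot> zh) = - (y0 \<cdot> zh)" and yhz0: "refl x (yh \<cdot> z0) = - (yh \<cdot> z0)"
      using ax y z odd commute[of yh z0] by auto
    show ?thesis
      unfolding y z refl_linear mu_left mu_right
using y(2,3) z(2,3) commute[of y0 x] commute[of yh x] idem even1[of 1]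
      by (simp add: even1 even0 odd y0z0 yhzh y0zh yhz0)
  qed
  ultimately show "axis_identities x"
    using idem nz by (simp add: axis_identities_def)
qed

text \<open>Parity under \<open>refl x\<close> only separates the 1/2-eigenspace from the other two.
  Where a fusion rule demands more, as for products with an element of the 0-eigenspace,
  \<open>Bp\<close> supplies the missing orthogonality to \<open>x\<close>.\<close>

lemma prim_axis_halfI:
  assumes "axis_identities x"
  shows "prim_axis_half sc mu x"
proof -
  define h where "h = (1 / 2 :: 'k)"
  have h: "2 * h = 1" using two_neq_0 by (simp add: h_def)
  then have h4: "4 * h = 2" by algebra
  have nz: "x \<noteq> 0" and idem: "x \<cdot> x = x"
    and E: "\<And>y. 2 *s (x \<cdot> (x \<cdot> y)) = x \<cdot> y + B x y *s x"
    and T: "\<And>y z. refl x (y \<cdot> z) = refl x y \<cdot> refl x z"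
    using assms by (auto simp: axis_identities_def)
  have Bc: "r = 0" if "r *s x = 0" for r
    using that nz by simp
  have one: "y = B x y *s x" if "x \<cdot> y = y" for y
  proof (rule vec_eqI)
    fix f assume f: "functional f"
    show "f y = f (B x y *s x)"
      using arg_cong[OF E[of y], of f] by (simp add: functional_simps[OF f] that)
  qed
  have zero: "B x y = 0" if "x \<cdot> y = 0" for y
    using E[of y] that Bc by simp
  have hf: "B x y = 0" if "x \<cdot> y = h *s y" for y
  proof (rule Bc, rule vec_eqI)
    fix f assume f: "functional f"
    show "f (B x y *s x) = f 0"
      using arg_cong[OF E[of y], of f] h by (simp add: functional_simps[OF f] that; algebra)
  qed
  have even0: "refl x y = y" if "x \<cdot> y = 0" for y
    using that zero by (simp add: refl_def)
  have odd: "refl x y = - y" if "x \<cdot> y = h *s y" for y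
  proof (rule vec_eqI)
    fix f assume f: "functional f"
    show "f (refl x y) = f (- y)"
      using that hf[OF that] h h4 by (simp add: refl_def functional_simps[OF f])
  qed
  have evenD: "x \<cdot> y = B x y *s x" if "refl x y = y" for y
  proof (rule vec_eqI)
    fix f assume f: "functional f"
    show "f (x \<cdot> y) = f (B x y *s x)"
      using arg_cong[OF that, of f] h by (simp add: refl_def functional_simps[OF f]; algebra)
  qed
  have oddD: "x \<cdot> y = h *s y" if "refl x y = - y" "B x y = 0" for y
  proof (rule vec_eqI_scaled[OF four_neq_0])
    fix f assume f: "functional f"
    show "4 * f (x \<cdot> y) = 4 * f (h *s y)"
      using arg_cong[OF that(1), of f] that(2) h
      by (simp only: refl_def functional_simps[OF f]) algebra
  qed
  have Bp: "B x (y \<cdot> z) = 0" if "x \<cdot> y = 0" for y z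
    using form_assoc[of x y z] that by simp
  have hh: "\<exists>w1 w0. x \<cdot> w1 = 1 *s w1 \<and> x \<cdot> w0 = 0 *s w0 \<and> y \<cdot> z = w1 + w0"
    if "x \<cdot> y = h *s y" "x \<cdot> z = h *s z" for y z
  proof -
    have "x \<cdot> (y \<cdot> z) = B x (y \<cdot> z) *s x"
      using that T[of y z] odd by (intro evenD) simp
    then have "x \<cdot> (B x (y \<cdot> z) *s x) = 1 *s (B x (y \<cdot> z) *s x) \<and>
        x \<cdot> (y \<cdot> z - B x (y \<cdot> z) *s x) = 0 *s (y \<cdot> z - B x (y \<cdot> z) *s x)"
      by (simp add: idem)
    then show ?thesis by (metis add_diff_cancel_left' add_diff_eq)
  qed
  have dec: "\<exists>u1 u0 uh. x \<cdot> u1 = 1 *s u1 \<and> x \<cdot> u0 = 0 *s u0 \<and> x \<cdot> uh = h *s uh \<and> y = u1 + u0 + uh" for y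
  proof (intro exI conjI)
    \<comment> \<open>The witnesses solve \<open>y = s *s x + y0 + yh\<close> and twice
      \<open>x \<cdot> y\<close> equal to \<open>2 *s s *s x + yh\<close>, with
      \<open>s = B x y\<close>.\<close>
    show "x \<cdot> (B x y *s x) = 1 *s (B x y *s x)" by (simp add: idem)
    show "x \<cdot> (y - 2 *s (x \<cdot> y) + B x y *s x) = 0 *s (y - 2 *s (x \<cdot> y) + B x y *s x)"
      using E[of y] by (simp add: idem)
    show "x \<cdot> (2 *s (x \<cdot> y) - 2 *s B x y *s x) = h *s (2 *s (x \<cdot> y) - 2 *s B x y *s x)"
    proof (rule vec_eqI)
      fix f assume f: "functional f"
      show "f (x \<cdot> (2 *s (x \<cdot> y) - 2 *s B x y *s x)) = f (h *s (2 *s (x \<cdot> y) - 2 *s B x y *s x))"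
        using arg_cong[OF E[of y], of f] h by (simp add: functional_simps[OF f] idem) algebra
    qed
    show "y = B x y *s x + (y - 2 *s (x \<cdot> y) + B x y *s x) + (2 *s (x \<cdot> y) - 2 *s B x y *s x)"
      by (rule vec_eqI') simp
  qed
  show ?thesis
    unfolding prim_axis_half_def Let_def eigsp_def h_def[symmetric] mem_Collect_eq Ball_def
  proof (intro conjI allI impI)
    show "x \<noteq> 0" "x \<cdot> x = x" by (fact nz idem)+
    show "\<exists>u1 u0 uh. x \<cdot> u1 = 1 *s u1 \<and> x \<cdot> u0 = 0 *s u0 \<and> x \<cdot> uh = h *s uh \<and> y = u1 + u0 + uh" for y
      by (rule dec)
    show A1: "{u. x \<cdot> u = 1 *s u} = range (\<lambda>c. c *s x)"
      using one idem by auto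
    show "x \<cdot> (u \<cdot> v) = 1 *s (u \<cdot> v)" if "x \<cdot> u = 1 *s u" "x \<cdot> v = 1 *s v" for u v
      using one[of u] one[of v] that idem by (metis mu_left(4) mu_right(4) scale_one)
    show "u \<cdot> v = 0" if "x \<cdot> u = 1 *s u" "x \<cdot> v = 0 *s v" for u v
      using one[of u] that by (metis mu_left(4) scale_one scale_zero_left scale_zero_right)
    show "x \<cdot> (u \<cdot> v) = 0 *s (u \<cdot> v)" if "x \<cdot> u = 0 *s u" "x \<cdot> v = 0 *s v" for u v
      using that T[of u v] even0 Bp evenD[of "u \<cdot> v"] by simp
    show "x \<cdot> (u \<cdot> v) = h *s (u \<cdot> v)" if "x \<cdot> u = 1 *s u" "x \<cdot> v = h *s v" for u v
      using one[of u] that by (metis mu_left(4) mu_right(4) scale_one)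
    show "x \<cdot> (u \<cdot> v) = h *s (u \<cdot> v)" if "x \<cdot> u = 0 *s u" "x \<cdot> v = h *s v" for u v
      using that T[of u v] even0 odd Bp by (intro oddD) simp_all
    show "\<exists>w1 w0. x \<cdot> w1 = 1 *s w1 \<and> x \<cdot> w0 = 0 *s w0 \<and> u \<cdot> v = w1 + w0"
      if "x \<cdot> u = h *s u" "x \<cdot> v = h *s v" for u v
      using that by (rule hh)
  qed
qed

end

subsection \<open>The action of the two-generated subalgebra\<close>

locale axis_pair = form_algebra sc mu B
  for sc :: "'k::field \<Rightarrow> 'a::ab_group_add \<Rightarrow> 'a" (infixr "*s" 75)
    and mu :: "'a \<Rightarrow> 'a \<Rightarrow> 'a" (infixl "\<cdot>" 70)
    and B :: "'a \<Rightarrow> 'a \<Rightarrow> 'k" +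
  fixes a b :: 'a
  assumes axis_a: "axis_identities a" and axis_b: "axis_identities b"
    and form_ba: "B b a = B a b"
    and form_ab_neq: "B a b \<noteq> 0" "B a b \<noteq> 1" "4 * B a b \<noteq> 1"
begin

abbreviation \<alpha> :: 'k where "\<alpha> \<equiv> B a b"
abbreviation \<beta> :: 'k where "\<beta> \<equiv> 2 * B a b - 1"

text \<open>\<open>e\<close> is the identity of \<open>J\<close>, and \<open>u\<close>, \<open>w\<close> span its complement, on which \<open>v \<cdot> v\<close> is a multiple of \<open>e\<close>;
  the idempotents of \<open>J\<close> other than \<open>0\<close>, \<open>e\<close> are the halves of \<open>e + v\<close> with \<open>v \<cdot> v = e\<close>.\<close>

definition e :: 'a where "e = (1 / (\<alpha> - 1)) *s (2 *s (a \<cdot> b) - a - b)"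
definition u :: 'a where "u = 2 *s a - e"
definition w :: 'a where "w = 2 *s b - e"

lemmas lin = mu_right mu_left form_right form_left

lemma one_minus_neq_0 [simp]: "\<alpha> \<noteq> 1" "1 \<noteq> \<alpha>" "1 - \<alpha> \<noteq> 0"
  using form_ab_neq by simp_all

lemma axisD:
  assumes "axis_identities c"
  shows "c \<noteq> 0" "c \<cdot> c = c" "2 *s (c \<cdot> (c \<cdot> x)) = c \<cdot> x + B c x *s c"
    "refl c (x \<cdot> y) = refl c x \<cdot> refl c y"
  using assms by (auto simp: axis_identities_def)

lemma axis_form_1:
  assumes "axis_identities c"
  shows "B c c = 1"
proof -
  have "(B c c - 1) *s c = 0"
  proof (rule vec_eqI)
    fix f assume f: "functional f"
    show "f ((B c c - 1) *s c) = f 0"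
      using axisD(3)[OF assms, of c, THEN arg_cong[where f=f]]
      by (simp (no_asm_use) only: functional_simps[OF f] axisD(2)[OF assms]) algebra
  qed
  then show ?thesis using axisD(1)[OF assms] by simp
qed

lemma prod_ab: "2 *s (a \<cdot> b) = a + b + (\<alpha> - 1) *s e"
proof -
  have "(\<alpha> - 1) *s e = 2 *s (a \<cdot> b) - a - b"
    using form_ab_neq by (simp add: e_def)
  then show ?thesis by simp
qed

text \<open>Multiplying \<open>prod_ab\<close> by an axis and inserting its quadratic identity
  leaves only terms with factor \<open>1 - \<alpha>\<close>.\<close>

lemma axis_mu_e:
  shows "a \<cdot> e = a" "b \<cdot> e = b"
proof -
  show "a \<cdot> e = a"
  proof (rule vec_eqI_scaled[OF one_minus_neq_0(3)])
    fix f assume f: "functional f"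
    show "(1 - \<alpha>) * f (a \<cdot> e) = (1 - \<alpha>) * f a"
      using prod_ab[THEN arg_cong[where f="\<lambda>x. f (a \<cdot> x)"]] axisD(3)[OF axis_a, of b, THEN arg_cong[where f=f]]
        prod_ab[THEN arg_cong[where f=f]]
      by (simp (no_asm_use) only: functional_simps[OF f] lin axisD(2)[OF axis_a]) algebra
  qed
  show "b \<cdot> e = b"
  proof (rule vec_eqI_scaled[OF one_minus_neq_0(3)])
    fix f assume f: "functional f"
    show "(1 - \<alpha>) * f (b \<cdot> e) = (1 - \<alpha>) * f b"
      using prod_ab[THEN arg_cong[where f="\<lambda>x. f (b \<cdot> x)"]] axisD(3)[OF axis_b, of a, THEN arg_cong[where f=f]]
        prod_ab[THEN arg_cong[where f=f]]
      by (simp (no_asm_use) only: functional_simps[OF f] lin axisD(2)[OF axis_b] form_ba commute[of b a]) algebra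
  qed
qed

lemma form_axis_e: "B a e = 1" "B b e = 1" "B e a = 1" "B e b = 1" "B e e = 2"
proof -
  show "B a e = 1" "B b e = 1" "B e a = 1" "B e b = 1"
    using form_assoc[of a a e] form_assoc[of b b e] form_assoc[of e a a] form_assoc[of e b b]
    by (simp_all add: axisD(2)[OF axis_a] axisD(2)[OF axis_b] axis_mu_e axis_form_1 axis_a axis_b
        commute[of e])
  have "2 * B (a \<cdot> b) e = B a e + B b e + (\<alpha> - 1) * B e e"
    using arg_cong[OF prod_ab, of "\<lambda>x. B x e"] by simp
  then have "2 * \<alpha> = 2 + (\<alpha> - 1) * B e e"
    using \<open>B a e = 1\<close> \<open>B b e = 1\<close> by (simp add: form_assoc axis_mu_e)
  then have "(1 - \<alpha>) * (B e e - 2) = 0" by algebra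
  then show "B e e = 2" by simp
qed

lemma refl_ab: "refl a b = (2 * \<beta>) *s a - b + (2 * (1 - \<alpha>)) *s e"
proof (rule vec_eqI)
  fix f assume f: "functional f"
  show "f (refl a b) = f ((2 * \<beta>) *s a - b + (2 * (1 - \<alpha>)) *s e)"
    using prod_ab[THEN arg_cong[where f=f]]
    by (simp (no_asm_use) only: functional_simps[OF f] refl_def) algebra
qed

lemma refl_axis_e: "refl a e = e" "refl b e = e"
  by (simp_all add: refl_def axis_mu_e form_axis_e)

text \<open>Applying the involution of \<open>a\<close> to \<open>b \<cdot> e = b\<close> shows that
  \<open>e\<close> also fixes \<open>refl a b\<close>. In this vector \<open>e\<close> has the
  coefficient \<open>2 * (1 - \<alpha>)\<close>, and the products of \<open>e\<close> with the other
  terms are known.\<close>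

lemma e_idem: "e \<cdot> e = e"
proof (rule vec_eqI_scaled[where k="4 * (1 - \<alpha>)"])
  fix f assume f: "functional f"
  have "refl a (b \<cdot> e) = refl a b \<cdot> refl a e" by (rule axisD(4)[OF axis_a])
  then have "refl a b = refl a b \<cdot> e" by (simp add: axis_mu_e refl_axis_e)
  from this[THEN arg_cong[where f=f]]
  show "4 * (1 - \<alpha>) * f (e \<cdot> e) = 4 * (1 - \<alpha>) * f e"
    unfolding refl_ab
    by (simp (no_asm_use) only: functional_simps[OF f] lin axis_mu_e) algebra
qed simp

text \<open>An involution fixing \<open>e\<close> commutes with multiplication by \<open>e\<close>.
  Its rank-one term does so as well, because the axis is fixed by \<open>e\<close>, so the remaining
  term, multiplication by the axis, commutes too.\<close>

lemma mu_e_comm: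
  shows "a \<cdot> (e \<cdot> x) = e \<cdot> (a \<cdot> x)" "b \<cdot> (e \<cdot> x) = e \<cdot> (b \<cdot> x)"
proof -
  have "c \<cdot> (e \<cdot> x) = e \<cdot> (c \<cdot> x)" if c: "axis_identities c" "c \<cdot> e = c" "B c e = 1" for c
  proof (rule vec_eqI_scaled[OF four_neq_0])
    fix f assume f: "functional f"
    have "refl c e = e" using c by (simp add: refl_def)
    then have "refl c (e \<cdot> x) = e \<cdot> refl c x" using axisD(4)[OF c(1), of e x] by simp
    from this[THEN arg_cong[where f=f]]
    show "4 * f (c \<cdot> (e \<cdot> x)) = 4 * f (e \<cdot> (c \<cdot> x))"
      by (simp (no_asm_use) only: functional_simps[OF f] lin refl_def form_assoc[of c e x, symmetric]
          commute[of e c] c(2)) algebra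
  qed
  then show "a \<cdot> (e \<cdot> x) = e \<cdot> (a \<cdot> x)" "b \<cdot> (e \<cdot> x) = e \<cdot> (b \<cdot> x)"
    using axis_a axis_b axis_mu_e form_axis_e by auto
qed

lemma plane_products:
  "u \<cdot> u = e" "w \<cdot> w = e" "u \<cdot> w = \<beta> *s e" "w \<cdot> u = \<beta> *s e"
  "e \<cdot> u = u" "u \<cdot> e = u" "e \<cdot> w = w" "w \<cdot> e = w"
proof -
  have ea: "e \<cdot> a = a" "e \<cdot> b = b" using axis_mu_e commute by metis+
  show "u \<cdot> u = e" "w \<cdot> w = e" "e \<cdot> u = u" "u \<cdot> e = u" "e \<cdot> w = w" "w \<cdot> e = w"
    by ((rule vec_eqI', simp add: u_def w_def ea axis_mu_e e_idem axisD(2) axis_a axis_b); algebra)+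
  show *: "u \<cdot> w = \<beta> *s e"
  proof (rule vec_eqI)
    fix f assume f: "functional f"
    show "f (u \<cdot> w) = f (\<beta> *s e)"
      using prod_ab[THEN arg_cong[where f=f]]
      by (simp (no_asm_use) only: functional_simps[OF f] lin u_def w_def ea axis_mu_e e_idem) algebra
  qed
  then show "w \<cdot> u = \<beta> *s e" by (simp add: commute)
qed

lemma plane_form:
  "B e u = 0" "B e w = 0" "B u e = 0" "B w e = 0"
  "B u u = 2" "B w w = 2" "B u w = 2 * \<beta>" "B w u = 2 * \<beta>"
  using form_axis_e form_ba axis_form_1[OF axis_a] axis_form_1[OF axis_b]
  by (simp_all add: u_def w_def)

definition perp :: "'a \<Rightarrow> bool" where
  "perp x \<longleftrightarrow> B a x = 0 \<and> B b x = 0 \<and> B e x = 0"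

lemma perp_linear:
  "perp x \<Longrightarrow> perp y \<Longrightarrow> perp (x + y)" "perp x \<Longrightarrow> perp y \<Longrightarrow> perp (x - y)" "perp x \<Longrightarrow> perp (c *s x)"
  by (simp_all add: perp_def)

lemma perpD:
  assumes "perp x"
  shows "B a x = 0" "B b x = 0" "B e x = 0" "B u x = 0" "B w x = 0"
  using assms by (simp_all add: perp_def u_def w_def)

text \<open>The complement of a subalgebra is stable under it, by associativity of the form; the
  products of \<open>a\<close>, \<open>b\<close>, \<open>e\<close> stay in their span by
  \<open>prod_ab\<close>.\<close>

lemma perp_mu:
  assumes "perp x"
  shows "perp (a \<cdot> x)" "perp (b \<cdot> x)" "perp (e \<cdot> x)" "perp (u \<cdot> x)" "perp (w \<cdot> x)"
proof -
  have ab: "B (a \<cdot> b) x = 0"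
  proof -
    have "2 * B (a \<cdot> b) x = 0"
      using arg_cong[OF prod_ab, of "\<lambda>y. B y x"] perpD[OF assms] by simp
    then show ?thesis using two_neq_0 by simp
  qed
  then have ba: "B (b \<cdot> a) x = 0" by (simp add: commute)
  show *: "perp (a \<cdot> x)" "perp (b \<cdot> x)" "perp (e \<cdot> x)"
    using perpD[OF assms] ab ba
    by (simp_all add: perp_def form_assoc[symmetric, of _ _ x] axisD(2) axis_a axis_b axis_mu_e commute[of e a] commute[of e b] e_idem)
  then show "perp (u \<cdot> x)" "perp (w \<cdot> x)"
    by (simp_all add: u_def w_def perp_linear)
qed

text \<open>This is \<open>refl c (d \<cdot> x) = refl c d \<cdot> refl c x\<close> read on the complement of \<open>J\<close>. The right-hand side is symmetric in the two
  axes, so comparison with the swapped instance isolates the action of \<open>e\<close> on \<open>c - d\<close>.\<close>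

lemma pair_identity:
  assumes c: "axis_identities c" and cd: "2 *s (c \<cdot> d) = c + d + (\<alpha> - 1) *s e" "B c d = \<alpha>"
    and x: "B c x = 0" "B d x = 0" "B e x = 0"
  shows "2 *s (d \<cdot> x) + (2 * \<beta>) *s (c \<cdot> x) + (8 * (1 - \<alpha>)) *s (e \<cdot> (c \<cdot> x))
    = 4 *s (c \<cdot> (d \<cdot> x) + d \<cdot> (c \<cdot> x)) + (2 * (1 - \<alpha>)) *s (e \<cdot> x)"
proof (rule vec_eqI)
  fix f assume f: "functional f"
  have "2 * B (c \<cdot> d) x = 0"
    using arg_cong[OF cd(1), of "\<lambda>y. B y x"] x by simp
  then have "B c (d \<cdot> x) = 0" using two_neq_0 by (simp add: form_assoc)
  have "refl c d = (2 * \<beta>) *s c - d + (2 * (1 - \<alpha>)) *s e"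
  proof (rule vec_eqI)
    fix f assume f: "functional f"
    show "f (refl c d) = f ((2 * \<beta>) *s c - d + (2 * (1 - \<alpha>)) *s e)"
      using cd(1)[THEN arg_cong[where f=f]]
      by (simp (no_asm_use) only: functional_simps[OF f] refl_def cd(2)) algebra
  qed
  moreover have "refl c x = x - 4 *s (c \<cdot> x)" by (simp add: refl_def x)
  moreover have "refl c (d \<cdot> x) = d \<cdot> x - 4 *s (c \<cdot> (d \<cdot> x))"
    by (simp add: refl_def \<open>B c (d \<cdot> x) = 0\<close>)
  ultimately have *: "d \<cdot> x - 4 *s (c \<cdot> (d \<cdot> x)) =
      ((2 * \<beta>) *s c - d + (2 * (1 - \<alpha>)) *s e) \<cdot> (x - 4 *s (c \<cdot> x))"
    using axisD(4)[OF c, of d x] by simp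
  have **: "2 *s (c \<cdot> (c \<cdot> x)) = c \<cdot> x"
    using axisD(3)[OF c, of x] by (simp add: x)
  show "f (2 *s (d \<cdot> x) + (2 * \<beta>) *s (c \<cdot> x) + (8 * (1 - \<alpha>)) *s (e \<cdot> (c \<cdot> x)))
    = f (4 *s (c \<cdot> (d \<cdot> x) + d \<cdot> (c \<cdot> x)) + (2 * (1 - \<alpha>)) *s (e \<cdot> x))"
    using *[THEN arg_cong[where f=f]] **[THEN arg_cong[where f=f]]
    by (simp (no_asm_use) only: functional_simps[OF f] lin) algebra
qed

text \<open>The kernel of \<open>Y\<close> is the 1/2-eigenspace of \<open>e\<close>. The aim of the
  following lemmas is \<open>Y_u\<close>: the plane maps the complement of J into this
  eigenspace.\<close>

definition Y :: "'a \<Rightarrow> 'a" where "Y x = 2 *s (e \<cdot> x) - x"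

lemma Y_linear:
  "Y (x + y) = Y x + Y y" "Y (x - y) = Y x - Y y" "Y (c *s x) = c *s Y x"
  by (rule vec_eqI', simp add: Y_def ring_distribs)+

context
  fixes x
  assumes x: "perp x"
begin

lemma Y_uw: "Y (w \<cdot> x) = Y (u \<cdot> x)"
proof (rule vec_eqI_scaled[where k="4 * (1 - \<alpha>)"])
  fix f assume f: "functional f"
  have "2 *s (b \<cdot> a) = b + a + (\<alpha> - 1) *s e" using prod_ab commute[of a b] by (simp add: add.commute)
  then have *: "2 *s (a \<cdot> x) + (2 * \<beta>) *s (b \<cdot> x) + (8 * (1 - \<alpha>)) *s (e \<cdot> (b \<cdot> x))
    = 4 *s (b \<cdot> (a \<cdot> x) + a \<cdot> (b \<cdot> x)) + (2 * (1 - \<alpha>)) *s (e \<cdot> x)"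
    using perpD[OF x] by (intro pair_identity axis_b form_ba)
  show "4 * (1 - \<alpha>) * f (Y (w \<cdot> x)) = 4 * (1 - \<alpha>) * f (Y (u \<cdot> x))"
    using *[THEN arg_cong[where f=f]]
      pair_identity[OF axis_a prod_ab refl perpD(1-3)[OF x], THEN arg_cong[where f=f]]
    by (simp (no_asm_use) only: functional_simps[OF f] lin u_def w_def Y_def) algebra
qed simp

text \<open>This is the quadratic identity of an axis on the complement of J, with twice the axis
  written as \<open>e + u\<close> or \<open>e + w\<close>.\<close>

lemma perp_u_u: "u \<cdot> (u \<cdot> x) = e \<cdot> x - e \<cdot> (e \<cdot> x) - Y (u \<cdot> x)"
  and perp_w_w: "w \<cdot> (w \<cdot> x) = e \<cdot> x - e \<cdot> (e \<cdot> x) - Y (w \<cdot> x)"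
proof -
  have *: "2 *s (a \<cdot> (a \<cdot> x)) = a \<cdot> x" "2 *s (b \<cdot> (b \<cdot> x)) = b \<cdot> x"
    using axisD(3)[OF axis_a, of x] axisD(3)[OF axis_b, of x] perpD[OF x] by simp_all
  show "u \<cdot> (u \<cdot> x) = e \<cdot> x - e \<cdot> (e \<cdot> x) - Y (u \<cdot> x)"
  proof (rule vec_eqI_scaled[OF four_neq_0])
    fix f assume f: "functional f"
    show "4 * f (u \<cdot> (u \<cdot> x)) = 4 * f (e \<cdot> x - e \<cdot> (e \<cdot> x) - Y (u \<cdot> x))"
      using *(1)[symmetric, THEN arg_cong[where f=f]]
      by (simp (no_asm_use) only: functional_simps[OF f] lin u_def Y_def mu_e_comm) algebra
  qed
  show "w \<cdot> (w \<cdot> x) = e \<cdot> x - e \<cdot> (e \<cdot> x) - Y (w \<cdot> x)"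
  proof (rule vec_eqI_scaled[OF four_neq_0])
    fix f assume f: "functional f"
    show "4 * f (w \<cdot> (w \<cdot> x)) = 4 * f (e \<cdot> x - e \<cdot> (e \<cdot> x) - Y (w \<cdot> x))"
      using *(2)[symmetric, THEN arg_cong[where f=f]]
      by (simp (no_asm_use) only: functional_simps[OF f] lin w_def Y_def mu_e_comm) algebra
  qed
qed

lemma perp_u_w: "u \<cdot> (w \<cdot> x) + w \<cdot> (u \<cdot> x) = (2 * \<beta>) *s (e \<cdot> x - e \<cdot> (e \<cdot> x)) - (2 * \<alpha>) *s Y (u \<cdot> x)"
proof (rule vec_eqI)
  fix f assume f: "functional f"
  show "f (u \<cdot> (w \<cdot> x) + w \<cdot> (u \<cdot> x)) = f ((2 * \<beta>) *s (e \<cdot> x - e \<cdot> (e \<cdot> x)) - (2 * \<alpha>) *s Y (u \<cdot> x))"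
    using pair_identity[OF axis_a prod_ab refl perpD(1-3)[OF x], THEN arg_cong[where f=f]]
      Y_uw[THEN arg_cong[where f=f]]
    by (simp (no_asm_use) only: functional_simps[OF f] lin u_def w_def Y_def mu_e_comm) algebra
qed

end

lemma Y_Y: "Y (Y x) = x - 4 *s (e \<cdot> x - e \<cdot> (e \<cdot> x))"
  by ((rule vec_eqI', simp add: Y_def); algebra)

text \<open>Under an outer \<open>Y\<close> the leading factor \<open>w\<close> may be replaced by
  \<open>u\<close> and conversely, by \<open>Y_uw\<close>. So the mixed terms of
  \<open>perp_u_w\<close> become the squares of \<open>perp_u_u\<close> and \<open>perp_w_w\<close>,
  and comparing the two expressions leaves a multiple of \<open>1 - \<alpha>\<close>.\<close>

lemma YY_u:
  assumes x: "perp x"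
  shows "Y (Y (u \<cdot> x)) = 2 *s Y (e \<cdot> x - e \<cdot> (e \<cdot> x))"
proof (rule vec_eqI_scaled[where k="2 * (1 - \<alpha>)"])
  fix f assume f: "functional f"
  show "2 * (1 - \<alpha>) * f (Y (Y (u \<cdot> x))) = 2 * (1 - \<alpha>) * f (2 *s Y (e \<cdot> x - e \<cdot> (e \<cdot> x)))"
    using perp_u_w[OF x, THEN arg_cong[where f="\<lambda>z. f (Y z)"]]
      perp_u_u[OF x, THEN arg_cong[where f="\<lambda>z. f (Y z)"]]
      perp_w_w[OF x, THEN arg_cong[where f="\<lambda>z. f (Y z)"]]
      Y_uw[OF perp_mu(4)[OF x], THEN arg_cong[where f=f]]
      Y_uw[OF perp_mu(5)[OF x], THEN arg_cong[where f=f]]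
      Y_uw[OF x, THEN arg_cong[where f="\<lambda>z. f (Y z)"]]
    by (simp (no_asm_use) only: functional_simps[OF f] Y_linear) algebra
qed (use two_neq_0 in simp)

text \<open>Put z = \<open>u \<cdot> x\<close>. Applying \<open>YY_u\<close> to z instead of x and
  expanding \<open>u \<cdot> z\<close> by \<open>perp_u_u\<close> gives Y(Y(Y z)) = -4 Y(e z - e(e
  z)), whereas \<open>Y_Y\<close> gives the same right-hand side plus Y z.\<close>

lemma Y_u:
  assumes x: "perp x"
  shows "Y (u \<cdot> x) = 0"
proof (rule vec_eqI_scaled[OF four_neq_0])
  fix f assume f: "functional f"
  show "4 * f (Y (u \<cdot> x)) = 4 * f 0"
    using YY_u[OF perp_mu(4)[OF x], THEN arg_cong[where f=f]]
      perp_u_u[OF x, THEN arg_cong[where f="\<lambda>z. f (Y (Y z))"]]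
      YY_u[OF x, THEN arg_cong[where f="\<lambda>z. f (Y z)"]]
      Y_Y[of "u \<cdot> x", THEN arg_cong[where f="\<lambda>z. f (Y z)"]]
    by (simp (no_asm_use) only: functional_simps[OF f] Y_linear) algebra
qed

lemma perp_plane:
  assumes x: "perp x"
  shows "2 *s (e \<cdot> (u \<cdot> x)) = u \<cdot> x" "2 *s (e \<cdot> (w \<cdot> x)) = w \<cdot> x"
    "u \<cdot> (u \<cdot> x) = e \<cdot> x - e \<cdot> (e \<cdot> x)" "w \<cdot> (w \<cdot> x) = e \<cdot> x - e \<cdot> (e \<cdot> x)"
    "u \<cdot> (w \<cdot> x) + w \<cdot> (u \<cdot> x) = (2 * \<beta>) *s (e \<cdot> x - e \<cdot> (e \<cdot> x))"
  using Y_u[OF x] Y_uw[OF x] perp_u_u[OF x] perp_w_w[OF x] perp_u_w[OF x] by (simp_all add: Y_def)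

subsection \<open>Peirce decomposition with respect to the identity of J\<close>

text \<open>The algebra splits as \<open>J + W1 + W0 + H\<close>, where \<open>J + W1\<close>, \<open>W0\<close> and \<open>H\<close> are the eigenspaces of \<open>e\<close> for
  1, 0 and 1/2. The plane spanned by \<open>u\<close> and \<open>w\<close> kills \<open>W1\<close> and \<open>W0\<close> and acts on \<open>H\<close> as a Clifford module;
  \<open>4 *s q x\<close> is the component of \<open>x\<close> in \<open>H\<close>.\<close>

definition H :: "'a \<Rightarrow> bool" where "H x \<longleftrightarrow> 2 *s (e \<cdot> x) = x"
definition W0 :: "'a \<Rightarrow> bool" where "W0 x \<longleftrightarrow> e \<cdot> x = 0"
definition W1 :: "'a \<Rightarrow> bool" where "W1 x \<longleftrightarrow> perp x \<and> e \<cdot> x = x"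
definition q :: "'a \<Rightarrow> 'a" where "q x = e \<cdot> x - e \<cdot> (e \<cdot> x)"

lemma two_cancel: "2 *s x = 2 *s y \<Longrightarrow> x = y"
  using two_neq_0 by simp

lemma double_eqD: "2 * t = t \<Longrightarrow> t = 0" for t :: 'k
  by (metis add_cancel_right_right mult_2)

lemma double_vec_eqD: "2 *s x = x \<Longrightarrow> x = 0"
proof -
  assume "2 *s x = x"
  moreover have "2 *s x = x + x" by (rule vec_eqI') simp
  ultimately show "x = 0" by simp
qed

lemma form_e_mu: "B a (e \<cdot> x) = B a x" "B b (e \<cdot> x) = B b x" "B e (e \<cdot> x) = B e x"
  "B u (e \<cdot> x) = B u x" "B w (e \<cdot> x) = B w x"
  by (simp_all add: form_assoc[symmetric] axis_mu_e e_idem plane_products)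

lemma mu_e_comm_plane: "u \<cdot> (e \<cdot> x) = e \<cdot> (u \<cdot> x)" "w \<cdot> (e \<cdot> x) = e \<cdot> (w \<cdot> x)"
  by (simp_all add: u_def w_def mu_e_comm)

lemma q_linear: "q (x + y) = q x + q y" "q (x - y) = q x - q y" "q (c *s x) = c *s q x"
  by (rule vec_eqI', simp add: q_def ring_distribs)+

lemma q_mu: "q (a \<cdot> x) = a \<cdot> q x" "q (b \<cdot> x) = b \<cdot> q x" "q (e \<cdot> x) = e \<cdot> q x"
  by (simp_all add: q_def mu_e_comm)

lemma q_plane: "q a = 0" "q b = 0" "q e = 0" "q u = 0" "q w = 0"
  using axis_mu_e by (simp_all add: q_def commute[of e a] commute[of e b] e_idem plane_products)

text \<open>The polynomial t - t^2 behind \<open>q\<close> is 1/4 at 1/2 and vanishes at 0 and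
  1.\<close>

lemma H_q:
  assumes "H x"
  shows "4 *s q x = x"
proof (rule vec_eqI)
  fix f assume f: "functional f"
  have 1: "2 *s (e \<cdot> x) = x" using assms by (simp add: H_def)
  then have 2: "2 *s (e \<cdot> (e \<cdot> x)) = e \<cdot> x" using mu_right(4)[of e 2 "e \<cdot> x"] by simp
  show "f (4 *s q x) = f x"
    using 1[THEN eq_diff_0[where f=f]] 2[THEN eq_diff_0[where f=f]]
    by (simp (no_asm_use) only: functional_simps[OF f] lin q_def) algebra
qed

text \<open>On the complement \<open>q x\<close> equals \<open>u \<cdot> (u \<cdot> x)\<close>, and
  everything of the form \<open>u \<cdot> y\<close> with \<open>y\<close> in the complement lies in
  the 1/2-eigenspace.\<close>

lemma perp_Hq:
  assumes "perp x"
  shows "H (q x)"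
proof -
  have "2 *s (e \<cdot> (u \<cdot> (u \<cdot> x))) = u \<cdot> (u \<cdot> x)"
    by (intro perp_plane perp_mu assms)
  then show ?thesis by (simp only: H_def q_def perp_plane(3)[OF assms])
qed

lemma perp_qD: "perp x \<Longrightarrow> 4 *s q x = x \<Longrightarrow> H x"
  using perp_Hq[of "4 *s x"] by (simp add: q_linear perp_linear)

text \<open>Since \<open>e\<close> acts on J as the identity, pairing
  \<open>2 *s (e \<cdot> x) = x\<close> with an element of J doubles the value of the form without
  changing it.\<close>

lemma H_perp:
  assumes "H x"
  shows "perp x"
proof -
  have "2 *s (e \<cdot> x) = x" using assms by (simp add: H_def)
  then have "2 * B j (e \<cdot> x) = B j x" for j by (metis form_right(4))
  from this[of a] this[of b] this[of e] show ?thesis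
    unfolding form_e_mu perp_def by (auto intro: double_eqD)
qed

lemma W0_perp:
  assumes "W0 x"
  shows "perp x"
  using assms form_e_mu[of x] by (simp add: W0_def perp_def)

lemma comp_linear:
  "H x \<Longrightarrow> H y \<Longrightarrow> H (x + y)" "H x \<Longrightarrow> H y \<Longrightarrow> H (x - y)" "H x \<Longrightarrow> H (c *s x)"
proof -
  show "H x \<Longrightarrow> H y \<Longrightarrow> H (x + y)" "H x \<Longrightarrow> H y \<Longrightarrow> H (x - y)"
    by (simp_all add: H_def scale_right_distrib scale_right_diff_distrib)
  show "H (c *s x)" if "H x"
  proof -
    have "2 *s (e \<cdot> (c *s x)) = c *s (2 *s (e \<cdot> x))" by (simp add: mult.commute)
    then show ?thesis using that by (simp only: H_def)
  qed
qed

lemma H_mu: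
  assumes "H x"
  shows "H (u \<cdot> x)" "H (w \<cdot> x)"
  unfolding H_def using perp_plane(1,2)[OF H_perp[OF assms]] by auto

lemma H_square:
  assumes "H x"
  shows "4 *s (u \<cdot> (u \<cdot> x)) = x" "4 *s (w \<cdot> (w \<cdot> x)) = x"
    "2 *s (u \<cdot> (w \<cdot> x) + w \<cdot> (u \<cdot> x)) = \<beta> *s x"
proof -
  note 1 = perp_plane(3-5)[OF H_perp[OF assms], folded q_def]
  show "4 *s (u \<cdot> (u \<cdot> x)) = x" "4 *s (w \<cdot> (w \<cdot> x)) = x"
    unfolding 1 by (rule H_q[OF assms])+
  have "2 *s (u \<cdot> (w \<cdot> x) + w \<cdot> (u \<cdot> x)) = \<beta> *s (4 *s q x)"
    unfolding 1(3) scale_scale by (rule arg_cong[where f="\<lambda>t. t *s q x"]) algebra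
  then show "2 *s (u \<cdot> (w \<cdot> x) + w \<cdot> (u \<cdot> x)) = \<beta> *s x" unfolding H_q[OF assms] .
qed

lemma H_mu_axis:
  assumes "H x"
  shows "4 *s (a \<cdot> x) = 2 *s (u \<cdot> x) + x" "4 *s (b \<cdot> x) = 2 *s (w \<cdot> x) + x"
proof -
  note * = assms[unfolded H_def]
  show "4 *s (a \<cdot> x) = 2 *s (u \<cdot> x) + x"
  proof (rule vec_eqI)
    fix f assume f: "functional f"
    show "f (4 *s (a \<cdot> x)) = f (2 *s (u \<cdot> x) + x)"
      using *[THEN eq_diff_0[where f=f]]
      by (simp (no_asm_use) only: functional_simps[OF f] lin u_def) algebra
  qed
  show "4 *s (b \<cdot> x) = 2 *s (w \<cdot> x) + x"
  proof (rule vec_eqI)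
    fix f assume f: "functional f"
    show "f (4 *s (b \<cdot> x)) = f (2 *s (w \<cdot> x) + x)"
      using *[THEN eq_diff_0[where f=f]]
      by (simp (no_asm_use) only: functional_simps[OF f] lin w_def) algebra
  qed
qed

text \<open>As \<open>e\<close> commutes with the plane, the image of \<open>x\<close> would be an
  eigenvector of \<open>e\<close> for both 1 and 1/2.\<close>

lemma W1_plane:
  assumes "perp x" "e \<cdot> x = x"
  shows "u \<cdot> x = 0" "w \<cdot> x = 0"
proof -
  note mu_e_comm_plane[of x, unfolded assms(2), symmetric]
  then show "u \<cdot> x = 0" "w \<cdot> x = 0"
    using perp_plane(1,2)[OF assms(1)] double_vec_eqD by metis+
qed

lemma W0_plane:
  assumes "W0 x"
  shows "u \<cdot> x = 0" "w \<cdot> x = 0" "a \<cdot> x = 0" "b \<cdot> x = 0"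
proof -
  show *: "u \<cdot> x = 0" "w \<cdot> x = 0"
    using perp_plane(1,2)[OF W0_perp[OF assms]] mu_e_comm_plane[of x] assms by (simp_all add: W0_def)
  show "a \<cdot> x = 0" "b \<cdot> x = 0"
    using * assms two_neq_0 by (simp_all add: u_def w_def W0_def)
qed

lemma W1_axis:
  assumes "W1 x"
  shows "2 *s (a \<cdot> x) = x" "2 *s (b \<cdot> x) = x" "u \<cdot> x = 0" "w \<cdot> x = 0" "e \<cdot> x = x" "perp x"
proof -
  show *: "u \<cdot> x = 0" "w \<cdot> x = 0" "e \<cdot> x = x" "perp x"
    using W1_plane[of x] assms by (simp_all add: W1_def)
  show "2 *s (a \<cdot> x) = x" "2 *s (b \<cdot> x) = x"
    using * by (simp_all add: u_def w_def)
qed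

text \<open>This expresses \<open>q\<close> through \<open>a\<close> and \<open>b\<close> alone, so
  that a map commuting or anticommuting with \<open>a - b\<close> can be shown to respect the
  1/2-component before anything is known about how it interacts with \<open>e\<close>.\<close>

lemma diff_square:
  assumes "perp m"
  shows "(a - b) \<cdot> ((a - b) \<cdot> m) = (1 - \<alpha>) *s q m"
proof (rule vec_eqI_scaled[OF four_neq_0])
  fix f assume f: "functional f"
  note 1 = perp_plane(3-5)[OF assms, folded q_def]
  have "f ((u - w) \<cdot> ((u - w) \<cdot> m)) = 4 * f ((1 - \<alpha>) *s q m)"
    using 1[THEN eq_diff_0[where f=f]]
    by (simp (no_asm_use) only: functional_simps[OF f] lin) algebra
  moreover have "u - w = 2 *s (a - b)" by (rule vec_eqI') (simp add: u_def w_def)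
  ultimately have "2 * (2 * f ((a - b) \<cdot> ((a - b) \<cdot> m))) = 4 * f ((1 - \<alpha>) *s q m)"
    by (simp only: mu_left(4) mu_right(4) functional_simps[OF f])
  then show "4 * f ((a - b) \<cdot> ((a - b) \<cdot> m)) = 4 * f ((1 - \<alpha>) *s q m)"
    by simp
qed

lemma equal_action:
  assumes m: "perp m" and ab: "a \<cdot> m = b \<cdot> m"
  shows "e \<cdot> m = 2 *s (a \<cdot> m)" "e \<cdot> (e \<cdot> m) = e \<cdot> m"
proof -
  have "(1 - \<alpha>) *s q m = 0" using diff_square[OF m] ab by simp
  then have "q m = 0" by simp
  then show ee: "e \<cdot> (e \<cdot> m) = e \<cdot> m" by (simp add: q_def)
  then have "u \<cdot> (e \<cdot> m) = 0" by (intro W1_plane perp_mu m)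
  then have "u \<cdot> m = 0" using perp_plane(1)[OF m] mu_e_comm_plane by simp
  then show "e \<cdot> m = 2 *s (a \<cdot> m)" by (simp add: u_def)
qed

lemma plane_decomp: "\<exists>r s t y. x = r *s e + (s *s u + t *s w) + y \<and> perp y"
proof -
  \<comment> \<open>The matrix of the system for \<open>s\<close>, \<open>t\<close> is the Gram
    matrix of \<open>u\<close>, \<open>w\<close>; the coefficients come from its inverse, and
    \<open>1 - \<beta> * \<beta> = 4 * \<alpha> * (1 - \<alpha>)\<close>.\<close>
  define d where "d = inverse (8 * \<alpha> * (1 - \<alpha>))"
  have "(8::'k) = 2 * 4" by simp
  then have "(8::'k) \<noteq> 0" using two_neq_0 four_neq_0 by (metis mult_eq_0_iff)
  then have "8 * \<alpha> * (1 - \<alpha>) \<noteq> 0" using form_ab_neq by simp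
  then have d: "8 * \<alpha> * (1 - \<alpha>) * d = 1" unfolding d_def by (rule right_inverse)
  define r where "r = B e x / 2"
  have r: "2 * r = B e x" using two_neq_0 by (simp add: r_def)
  define s where "s = d * (B u x - \<beta> * B w x)"
  define t where "t = d * (B w x - \<beta> * B u x)"
  have "2 * s + 2 * \<beta> * t = (8 * \<alpha> * (1 - \<alpha>) * d) * B u x"
    "2 * \<beta> * s + 2 * t = (8 * \<alpha> * (1 - \<alpha>) * d) * B w x"
    unfolding s_def t_def by algebra+
  then have st: "2 * s + 2 * \<beta> * t = B u x" "2 * \<beta> * s + 2 * t = B w x"
    unfolding d by simp_all
  define y where "y = x - (r *s e + (s *s u + t *s w))"
  have "B e y = B e x - 2 * r" "B u y = B u x - (2 * s + 2 * \<beta> * t)"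
    "B w y = B w x - (2 * \<beta> * s + 2 * t)"
    unfolding y_def lin plane_form form_axis_e by algebra+
  then have y: "B e y = 0" "B u y = 0" "B w y = 0"
    unfolding r st by simp_all
  then have "2 * B a y = 0" "2 * B b y = 0"
    using y by (simp_all add: u_def w_def)
  with y have "perp y" using two_neq_0 by (simp add: perp_def)
  then show ?thesis by (intro exI[of _ r] exI[of _ s] exI[of _ t] exI[of _ y]) (simp add: y_def)
qed

lemma Hq: "H (q x)"
proof -
  obtain r s t y where "x = r *s e + (s *s u + t *s w) + y" "perp y" using plane_decomp by blast
  then show ?thesis using perp_Hq by (simp add: q_linear q_plane)
qed

lemma decomp:
  "\<exists>r s t y1 y0 h. x = r *s e + (s *s u + t *s w) + y1 + y0 + h \<and> W1 y1 \<and> W0 y0 \<and> H h"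
proof -
  obtain r s t y where x: "x = r *s e + (s *s u + t *s w) + y" and y: "perp y" using plane_decomp by blast
  \<comment> \<open>On the complement \<open>e\<close> is a root of t(t - 1)(2t - 1). The components
    below are the values of the interpolation polynomials 2t^2 - t, 1 - 3t + 2t^2 and 4t - 4t^2 at
    \<open>e\<close>.\<close>
  have *: "2 *s (e \<cdot> (e \<cdot> (e \<cdot> y))) = 3 *s (e \<cdot> (e \<cdot> y)) - e \<cdot> y"
  proof (rule vec_eqI)
    fix f assume f: "functional f"
    show "f (2 *s (e \<cdot> (e \<cdot> (e \<cdot> y)))) = f (3 *s (e \<cdot> (e \<cdot> y)) - e \<cdot> y)"
      using perp_Hq[OF y, unfolded H_def q_def, THEN eq_diff_0[where f=f]]
      by (simp (no_asm_use) only: functional_simps[OF f] lin) algebra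
  qed
  have "e \<cdot> (2 *s (e \<cdot> (e \<cdot> y)) - e \<cdot> y) = 2 *s (e \<cdot> (e \<cdot> y)) - e \<cdot> y"
  proof (rule vec_eqI)
    fix f assume f: "functional f"
    show "f (e \<cdot> (2 *s (e \<cdot> (e \<cdot> y)) - e \<cdot> y)) = f (2 *s (e \<cdot> (e \<cdot> y)) - e \<cdot> y)"
      using *[THEN eq_diff_0[where f=f]]
      by (simp (no_asm_use) only: functional_simps[OF f] lin) algebra
  qed
  then have 1: "W1 (2 *s (e \<cdot> (e \<cdot> y)) - e \<cdot> y)"
    unfolding W1_def by (intro conjI perp_linear perp_mu y)
  have "e \<cdot> (y - 3 *s (e \<cdot> y) + 2 *s (e \<cdot> (e \<cdot> y))) = 0"
  proof (rule vec_eqI)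
    fix f assume f: "functional f"
    show "f (e \<cdot> (y - 3 *s (e \<cdot> y) + 2 *s (e \<cdot> (e \<cdot> y)))) = f 0"
      using *[THEN eq_diff_0[where f=f]]
      by (simp (no_asm_use) only: functional_simps[OF f] lin) algebra
  qed
  then have 2: "W0 (y - 3 *s (e \<cdot> y) + 2 *s (e \<cdot> (e \<cdot> y)))"
    by (simp only: W0_def)
  have 3: "H (4 *s q y)" by (intro comp_linear Hq)
  have "x = r *s e + (s *s u + t *s w) + (2 *s (e \<cdot> (e \<cdot> y)) - e \<cdot> y)
      + (y - 3 *s (e \<cdot> y) + 2 *s (e \<cdot> (e \<cdot> y))) + 4 *s q y"
  proof (rule vec_eqI)
    fix f assume f: "functional f"
    show "f x = f (r *s e + (s *s u + t *s w) + (2 *s (e \<cdot> (e \<cdot> y)) - e \<cdot> y)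
      + (y - 3 *s (e \<cdot> y) + 2 *s (e \<cdot> (e \<cdot> y))) + 4 *s q y)"
      by (simp only: x functional_simps[OF f] q_def) algebra
  qed
  with 1 2 3 show ?thesis by blast
qed

section \<open>Products with the components W0 and W1\<close>

lemma W0_comm:
  assumes z: "W0 z"
  shows "a \<cdot> (z \<cdot> x) = z \<cdot> (a \<cdot> x)" "b \<cdot> (z \<cdot> x) = z \<cdot> (b \<cdot> x)" "perp (z \<cdot> x)"
proof -
  have *: "c \<cdot> (z \<cdot> x) = z \<cdot> (c \<cdot> x)" if c: "axis_identities c" "c \<cdot> z = 0" for c
  proof (rule vec_eqI_scaled[OF four_neq_0])
    fix f assume f: "functional f"
    have "B c z = 0" using form_assoc[of c c z] axisD(2)[OF c(1)] c(2) by simp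
    then have "refl c z = z" using c by (simp add: refl_def)
    \<comment> \<open>Multiplication by \<open>z\<close> commutes with an involution fixing
      \<open>z\<close>; the rank-one terms vanish since \<open>c\<close> kills
      \<open>z\<close>.\<close>
    then have "refl c (z \<cdot> x) = z \<cdot> refl c x" using axisD(4)[OF c(1), of z x] by simp
    moreover have "B c (z \<cdot> x) = 0" using form_assoc[of c z x] c by simp
    ultimately have "z \<cdot> x - 4 *s (c \<cdot> (z \<cdot> x)) = z \<cdot> x - 4 *s (z \<cdot> (c \<cdot> x))"
      using c(2) commute[of z c] by (simp add: refl_def)
    from this[THEN eq_diff_0[where f=f]]
    show "4 * f (c \<cdot> (z \<cdot> x)) = 4 * f (z \<cdot> (c \<cdot> x))"
      by (simp (no_asm_use) only: functional_simps[OF f]) algebra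
  qed
  show "a \<cdot> (z \<cdot> x) = z \<cdot> (a \<cdot> x)" "b \<cdot> (z \<cdot> x) = z \<cdot> (b \<cdot> x)"
    using * axis_a axis_b W0_plane[OF z] by auto
  show "perp (z \<cdot> x)"
    using W0_plane[OF z] z by (simp add: perp_def form_assoc[symmetric] W0_def)
qed

lemma W0_W0:
  assumes "W0 z" "W0 x"
  shows "W0 (z \<cdot> x)"
proof -
  have *: "a \<cdot> (z \<cdot> x) = 0" "b \<cdot> (z \<cdot> x) = 0"
    unfolding W0_comm(1,2)[OF assms(1)] W0_plane(3,4)[OF assms(2)] by simp_all
  have "e \<cdot> (z \<cdot> x) = 2 *s (a \<cdot> (z \<cdot> x))"
    by (rule equal_action(1)) (use W0_comm(3)[OF assms(1)] * in simp_all)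
  then show ?thesis unfolding * W0_def by simp
qed

lemma W0_W1:
  assumes "W0 z" "W1 x"
  shows "W1 (z \<cdot> x)"
proof -
  have "2 *s (a \<cdot> (z \<cdot> x)) = z \<cdot> (2 *s (a \<cdot> x))" "2 *s (b \<cdot> (z \<cdot> x)) = z \<cdot> (2 *s (b \<cdot> x))"
    unfolding W0_comm(1,2)[OF assms(1)] by simp_all
  then have *: "2 *s (a \<cdot> (z \<cdot> x)) = z \<cdot> x" "2 *s (b \<cdot> (z \<cdot> x)) = z \<cdot> x"
    unfolding W1_axis(1,2)[OF assms(2)] by simp_all
  have "e \<cdot> (z \<cdot> x) = 2 *s (a \<cdot> (z \<cdot> x))"
    by (rule equal_action(1)[OF W0_comm(3)[OF assms(1)]]) (rule two_cancel, simp only: *)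
  then show ?thesis unfolding * W1_def using W0_comm(3)[OF assms(1)] by blast
qed

text \<open>Multiplication by \<open>z\<close> commutes with \<open>a - b\<close>, hence with
  \<open>q\<close> by \<open>diff_square\<close>, so it preserves the 1/2-component; only then does
  commutation with \<open>e\<close>, and so with the plane, follow.\<close>

lemma W0_H:
  assumes z: "W0 z" and x: "H x"
  shows "H (z \<cdot> x)" "u \<cdot> (z \<cdot> x) = z \<cdot> (u \<cdot> x)" "w \<cdot> (z \<cdot> x) = z \<cdot> (w \<cdot> x)"
proof -
  have "(1 - \<alpha>) *s q (z \<cdot> x) = (1 - \<alpha>) *s (z \<cdot> q x)"
    using diff_square[OF W0_comm(3)[OF z], of x]
      arg_cong[OF diff_square[OF H_perp[OF x]], of "\<lambda>y. z \<cdot> y"]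
    by (simp add: W0_comm(1,2)[OF z])
  then have "q (z \<cdot> x) = z \<cdot> q x" by simp
  then have "4 *s q (z \<cdot> x) = z \<cdot> x" using H_q[OF x] mu_right(4) by metis
  then show H: "H (z \<cdot> x)" by (intro perp_qD W0_comm z)
  have "e \<cdot> (z \<cdot> x) = z \<cdot> (e \<cdot> x)"
    by (rule two_cancel) (metis H x H_def mu_right(4))
  then show "u \<cdot> (z \<cdot> x) = z \<cdot> (u \<cdot> x)" "w \<cdot> (z \<cdot> x) = z \<cdot> (w \<cdot> x)"
    by (simp_all add: u_def w_def W0_comm(1,2)[OF z])
qed

lemma W1_refl:
  assumes "W1 y"
  shows "refl a y = - y" "refl b y = - y"
proof -
  have "refl c y = - y" if "2 *s (c \<cdot> y) = y" "B c y = 0" for c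
  proof (rule vec_eqI)
    fix f assume f: "functional f"
    show "f (refl c y) = f (- y)"
      using that(1)[THEN eq_diff_0[where f=f]]
      by (simp (no_asm_use) only: functional_simps[OF f] refl_def that(2)) algebra
  qed
  then show "refl a y = - y" "refl b y = - y"
    using W1_axis[OF assms] perpD by auto
qed

text \<open>Both factors are odd for \<open>a\<close> and for \<open>b\<close>, so the product is
  even for both axes. The multiple of \<open>e\<close> is forced by
  \<open>B e (y \<cdot> x) = B y x\<close> and \<open>B e e = 2\<close>; what remains is killed by
  both axes.\<close>

lemma W1_W1:
  assumes y: "W1 y" and x: "W1 x"
  shows "W0 (2 *s (y \<cdot> x) - B y x *s e)"
proof -
  define m where "m = 2 *s (y \<cdot> x) - B y x *s e"
  have k: "2 * B a (y \<cdot> x) = B y x" "2 * B b (y \<cdot> x) = B y x" "B e (y \<cdot> x) = B y x"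
    using W1_axis[OF y] by (metis form_assoc form_left(4))+
  have act: "c \<cdot> m = 0" if c: "axis_identities c" "refl c y = - y" "refl c x = - x" "2 * B c (y \<cdot> x) = B y x" "c \<cdot> e = c" for c
  proof (rule vec_eqI_scaled[OF four_neq_0])
    fix f assume f: "functional f"
    have "refl c (y \<cdot> x) = y \<cdot> x" using axisD(4)[OF c(1), of y x] c by simp
    from this[THEN eq_diff_0[where f=f]]
    show "4 * f (c \<cdot> m) = 4 * f 0"
      using c(4)[symmetric]
      by (simp (no_asm_use) only: functional_simps[OF f] refl_def m_def lin c(5)) algebra
  qed
  have am: "a \<cdot> m = 0" "b \<cdot> m = 0"
    using act[of a] act[of b] axis_a axis_b W1_refl[OF y] W1_refl[OF x] k axis_mu_e by auto
  have "perp m"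
    using k by (simp add: perp_def m_def form_axis_e)
  then show ?thesis using equal_action(1)[of m] am by (simp add: W0_def m_def)
qed

lemma W1_H_form:
  assumes y: "W1 y" and x: "H x"
  shows "B y x = 0"
proof -
  have "B y x = 2 * B y (e \<cdot> x)" using x unfolding H_def by (metis form_right(4))
  also have "\<dots> = 2 * B y x" using W1_axis(5)[OF y] by (metis form_assoc commute)
  finally show ?thesis using double_eqD by metis
qed

text \<open>As both involutions negate \<open>y\<close>, multiplication by \<open>y\<close>
  anticommutes with \<open>a - b\<close> on H. Its square therefore commutes with \<open>y\<close>,
  and \<open>diff_square\<close> brings the product back into H.\<close>

lemma W1_H:
  assumes y: "W1 y" and x: "H x"
  shows "H (y \<cdot> x)" "u \<cdot> (y \<cdot> x) = - (y \<cdot> (u \<cdot> x))" "w \<cdot> (y \<cdot> x) = - (y \<cdot> (w \<cdot> x))"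
proof -
  have perp: "perp (y \<cdot> z)" if "H z" for z
  proof -
    have "2 * B a (y \<cdot> z) = B y z" "2 * B b (y \<cdot> z) = B y z" "B e (y \<cdot> z) = B y z"
      using W1_axis[OF y] by (metis form_assoc form_left(4))+
    then show ?thesis using W1_H_form[OF y that] two_neq_0 by (simp add: perp_def)
  qed
  have anti: "2 *s (c \<cdot> (y \<cdot> z)) + 2 *s (y \<cdot> (c \<cdot> z)) = y \<cdot> z"
    if z: "H z" and c: "axis_identities c" "refl c y = - y" "B c z = 0" "B c (y \<cdot> z) = 0" for c z
  proof (rule vec_eqI_scaled[OF two_neq_0])
    fix f assume f: "functional f"
    have "refl c (y \<cdot> z) = - (y \<cdot> refl c z)" using axisD(4)[OF c(1), of y z] c by simp
    from this[THEN eq_diff_0[where f=f]]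
    show "2 * f (2 *s (c \<cdot> (y \<cdot> z)) + 2 *s (y \<cdot> (c \<cdot> z))) = 2 * f (y \<cdot> z)"
      by (simp (no_asm_use) only: functional_simps[OF f] refl_def lin c(3,4)) algebra
  qed
  have anti_a: "2 *s (a \<cdot> (y \<cdot> z)) + 2 *s (y \<cdot> (a \<cdot> z)) = y \<cdot> z"
    and anti_b: "2 *s (b \<cdot> (y \<cdot> z)) + 2 *s (y \<cdot> (b \<cdot> z)) = y \<cdot> z" if "H z" for z
    using anti[OF that axis_a] anti[OF that axis_b] W1_refl[OF y] perpD[OF H_perp[OF that]]
      perpD[OF perp[OF that]] by auto
  have diff: "(a - b) \<cdot> (y \<cdot> z) = - (y \<cdot> ((a - b) \<cdot> z))" if "H z" for z
  proof (rule vec_eqI_scaled[OF two_neq_0])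
    fix f assume f: "functional f"
    show "2 * f ((a - b) \<cdot> (y \<cdot> z)) = 2 * f (- (y \<cdot> ((a - b) \<cdot> z)))"
      using anti_a[OF that, THEN eq_diff_0[where f=f]] anti_b[OF that, THEN eq_diff_0[where f=f]]
      by (simp (no_asm_use) only: functional_simps[OF f] lin) algebra
  qed
  have "2 *s ((a - b) \<cdot> x) = u \<cdot> x - w \<cdot> x"
    by (rule vec_eqI') (simp add: u_def w_def ring_distribs)
  then have "H (2 *s ((a - b) \<cdot> x))"
    by (simp only: comp_linear(2) H_mu x)
  then have "H ((1 / 2) *s (2 *s ((a - b) \<cdot> x)))" by (rule comp_linear)
  then have Hd: "H ((a - b) \<cdot> x)" using two_neq_0 by simp
  have "(1 - \<alpha>) *s q (y \<cdot> x) = (a - b) \<cdot> ((a - b) \<cdot> (y \<cdot> x))"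
    by (rule diff_square[OF perp[OF x], symmetric])
  also have "\<dots> = y \<cdot> ((a - b) \<cdot> ((a - b) \<cdot> x))"
    by (simp only: diff x Hd mu_right(3) minus_minus)
  also have "\<dots> = (1 - \<alpha>) *s (y \<cdot> q x)"
    by (simp only: diff_square[OF H_perp[OF x]] mu_right(4))
  finally have "(1 - \<alpha>) *s q (y \<cdot> x) = (1 - \<alpha>) *s (y \<cdot> q x)" .
  then have "q (y \<cdot> x) = y \<cdot> q x" by simp
  then have "4 *s q (y \<cdot> x) = y \<cdot> x" using H_q[OF x] mu_right(4) by metis
  then show H: "H (y \<cdot> x)" by (intro perp_qD perp x)
  have e1: "2 *s (e \<cdot> (y \<cdot> x)) = y \<cdot> x" using H by (simp only: H_def)
  have e2: "2 *s (y \<cdot> (e \<cdot> x)) = y \<cdot> x" by (metis x H_def mu_right(4))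
  show "u \<cdot> (y \<cdot> x) = - (y \<cdot> (u \<cdot> x))"
  proof (rule vec_eqI_scaled[OF two_neq_0])
    fix f assume f: "functional f"
    show "2 * f (u \<cdot> (y \<cdot> x)) = 2 * f (- (y \<cdot> (u \<cdot> x)))"
      using anti_a[OF x, THEN eq_diff_0[where f=f]] e1[THEN eq_diff_0[where f=f]] e2[THEN eq_diff_0[where f=f]]
      by (simp (no_asm_use) only: functional_simps[OF f] lin u_def) algebra
  qed
  show "w \<cdot> (y \<cdot> x) = - (y \<cdot> (w \<cdot> x))"
  proof (rule vec_eqI_scaled[OF two_neq_0])
    fix f assume f: "functional f"
    show "2 * f (w \<cdot> (y \<cdot> x)) = 2 * f (- (y \<cdot> (w \<cdot> x)))"
      using anti_b[OF x, THEN eq_diff_0[where f=f]] e1[THEN eq_diff_0[where f=f]] e2[THEN eq_diff_0[where f=f]]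
      by (simp (no_asm_use) only: functional_simps[OF f] lin w_def) algebra
  qed
qed

section \<open>The product of two elements of H has no component in H\<close>

lemma refl_H:
  assumes "H x"
  shows "refl a x = (-2) *s (u \<cdot> x)" "refl b x = (-2) *s (w \<cdot> x)"
proof -
  show "refl a x = (-2) *s (u \<cdot> x)"
    unfolding refl_def H_mu_axis[OF assms] perpD[OF H_perp[OF assms]] by simp
  show "refl b x = (-2) *s (w \<cdot> x)"
    unfolding refl_def H_mu_axis[OF assms] perpD[OF H_perp[OF assms]] by simp
qed

text \<open>On H the involution of \<open>a\<close> is -2 times multiplication by \<open>u\<close>,
  and it squares to the identity; applying multiplicativity to \<open>x\<close> and
  \<open>u \<cdot> y\<close> therefore restores \<open>y\<close>. The same holds for
  \<open>b\<close> and \<open>w\<close>.\<close>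

lemma H_H_move:
  assumes x: "H x" and y: "H y"
  shows "(u \<cdot> x) \<cdot> y = refl a (x \<cdot> (u \<cdot> y))" "(w \<cdot> x) \<cdot> y = refl b (x \<cdot> (w \<cdot> y))"
proof -
  have "refl a (x \<cdot> (u \<cdot> y)) = ((-2) *s (u \<cdot> x)) \<cdot> ((-2) *s (u \<cdot> (u \<cdot> y)))"
    by (simp only: axisD(4)[OF axis_a, of x "u \<cdot> y"] refl_H x H_mu[OF y])
  also have "\<dots> = (u \<cdot> x) \<cdot> (4 *s (u \<cdot> (u \<cdot> y)))" by simp
  finally show "(u \<cdot> x) \<cdot> y = refl a (x \<cdot> (u \<cdot> y))" by (simp only: H_square[OF y])
  have "refl b (x \<cdot> (w \<cdot> y)) = ((-2) *s (w \<cdot> x)) \<cdot> ((-2) *s (w \<cdot> (w \<cdot> y)))"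
    by (simp only: axisD(4)[OF axis_b, of x "w \<cdot> y"] refl_H x H_mu[OF y])
  also have "\<dots> = (w \<cdot> x) \<cdot> (4 *s (w \<cdot> (w \<cdot> y)))" by simp
  finally show "(w \<cdot> x) \<cdot> y = refl b (x \<cdot> (w \<cdot> y))" by (simp only: H_square[OF y])
qed

lemma q_refl: "q (refl a g) = (-2) *s (u \<cdot> q g)" "q (refl b g) = (-2) *s (w \<cdot> q g)"
proof -
  have "q (refl a g) = q g - 4 *s (a \<cdot> q g)" "q (refl b g) = q g - 4 *s (b \<cdot> q g)"
    by (simp_all add: refl_def q_linear q_mu q_plane)
  then show "q (refl a g) = (-2) *s (u \<cdot> q g)" "q (refl b g) = (-2) *s (w \<cdot> q g)"
    by (simp_all add: H_mu_axis[OF Hq])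
qed

lemma q_H_H:
  assumes x: "H x" and y: "H y"
  shows "2 *s q ((u \<cdot> x) \<cdot> (u \<cdot> y)) = - (u \<cdot> q (x \<cdot> y))"
    "2 *s q ((w \<cdot> x) \<cdot> (w \<cdot> y)) = - (w \<cdot> q (x \<cdot> y))"
proof -
  have "4 *s q ((u \<cdot> x) \<cdot> (u \<cdot> y)) = (-2) *s (u \<cdot> q (x \<cdot> (4 *s (u \<cdot> (u \<cdot> y)))))"
    unfolding H_H_move(1)[OF x H_mu(1)[OF y]] q_refl by (simp add: q_linear)
  then have "2 *s (2 *s q ((u \<cdot> x) \<cdot> (u \<cdot> y))) = 2 *s (- (u \<cdot> q (x \<cdot> y)))"
    unfolding H_square[OF y] by simp
  then show "2 *s q ((u \<cdot> x) \<cdot> (u \<cdot> y)) = - (u \<cdot> q (x \<cdot> y))" by (rule two_cancel)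
  have "4 *s q ((w \<cdot> x) \<cdot> (w \<cdot> y)) = (-2) *s (w \<cdot> q (x \<cdot> (4 *s (w \<cdot> (w \<cdot> y)))))"
    unfolding H_H_move(2)[OF x H_mu(2)[OF y]] q_refl by (simp add: q_linear)
  then have "2 *s (2 *s q ((w \<cdot> x) \<cdot> (w \<cdot> y))) = 2 *s (- (w \<cdot> q (x \<cdot> y)))"
    unfolding H_square[OF y] by simp
  then show "2 *s q ((w \<cdot> x) \<cdot> (w \<cdot> y)) = - (w \<cdot> q (x \<cdot> y))" by (rule two_cancel)
qed

text \<open>The rotation \<open>\<rho>\<close> has inverse \<open>\<sigma>\<close> on \<open>H\<close> and satisfies \<open>\<rho> + \<sigma> = 2 \<beta>\<close>. The map \<open>q (x \<cdot> y)\<close> on \<open>H\<close> is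
  equivariant under it, so if it is nonzero then eigenvalues \<open>z, 1/z\<close> of \<open>\<rho>\<close> satisfy \<open>z = 1\<close> or \<open>z^3 = 1\<close>, that is
  \<open>\<beta> = 1\<close> or \<open>\<beta> = -1/2\<close>; here the value 1/4 of the form is excluded. The argument below eliminates the
  eigenvalues, which need not lie in the field.\<close>

definition \<rho> :: "'a \<Rightarrow> 'a" where "\<rho> x = 4 *s (u \<cdot> (w \<cdot> x))"
definition \<sigma> :: "'a \<Rightarrow> 'a" where "\<sigma> x = 4 *s (w \<cdot> (u \<cdot> x))"

lemma H_rot: "H x \<Longrightarrow> H (\<rho> x)" "H x \<Longrightarrow> H (\<sigma> x)"
  by (simp_all add: \<rho>_def \<sigma>_def comp_linear H_mu)

lemma \<rho>_linear: "\<rho> (x - y) = \<rho> x - \<rho> y" "\<rho> (c *s x) = c *s \<rho> x"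
  by (rule vec_eqI', simp add: \<rho>_def ring_distribs)+

lemma \<sigma>_eq:
  assumes "H x"
  shows "\<sigma> x = (2 * \<beta>) *s x - \<rho> x"
proof (rule vec_eqI)
  fix f assume f: "functional f"
  show "f (\<sigma> x) = f ((2 * \<beta>) *s x - \<rho> x)"
    using H_square(3)[OF assms, THEN eq_diff_0[where f=f]]
    by (simp (no_asm_use) only: functional_simps[OF f] \<rho>_def \<sigma>_def) algebra
qed

lemma \<rho>_\<rho>:
  assumes "H x"
  shows "\<rho> (\<rho> x) = (2 * \<beta>) *s \<rho> x - x"
proof -
  have "\<rho> (\<sigma> x) = 4 *s (u \<cdot> (4 *s (w \<cdot> (w \<cdot> (u \<cdot> x)))))" by (simp add: \<rho>_def \<sigma>_def)
  also have "\<dots> = x" by (simp only: H_square H_mu assms)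
  finally have "\<rho> ((2 * \<beta>) *s x - \<rho> x) = x" by (simp only: \<sigma>_eq[OF assms])
  then have "(2 * \<beta>) *s \<rho> x - \<rho> (\<rho> x) = x" by (simp only: \<rho>_linear)
  then show ?thesis by (metis add_diff_cancel_left' diff_add_cancel)
qed

lemma q_rot:
  assumes x: "H x" and y: "H y"
  shows "q (\<rho> x \<cdot> \<rho> y) = \<rho> (q (x \<cdot> y))" "q (\<sigma> x \<cdot> \<sigma> y) = \<sigma> (q (x \<cdot> y))"
proof -
  have "q (\<rho> x \<cdot> \<rho> y) = 8 *s (2 *s q ((u \<cdot> (w \<cdot> x)) \<cdot> (u \<cdot> (w \<cdot> y))))"
    by (simp add: \<rho>_def q_linear)
  also have "\<dots> = - (4 *s (u \<cdot> (2 *s q ((w \<cdot> x) \<cdot> (w \<cdot> y)))))"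
    by (simp add: q_H_H(1)[OF H_mu(2)[OF x] H_mu(2)[OF y]])
  also have "\<dots> = \<rho> (q (x \<cdot> y))"
    by (simp only: q_H_H(2)[OF x y]) (simp add: \<rho>_def)
  finally show "q (\<rho> x \<cdot> \<rho> y) = \<rho> (q (x \<cdot> y))" .
  have "q (\<sigma> x \<cdot> \<sigma> y) = 8 *s (2 *s q ((w \<cdot> (u \<cdot> x)) \<cdot> (w \<cdot> (u \<cdot> y))))"
    by (simp add: \<sigma>_def q_linear)
  also have "\<dots> = - (4 *s (w \<cdot> (2 *s q ((u \<cdot> x) \<cdot> (u \<cdot> y)))))"
    by (simp add: q_H_H(2)[OF H_mu(1)[OF x] H_mu(1)[OF y]])
  also have "\<dots> = \<sigma> (q (x \<cdot> y))"
    by (simp only: q_H_H(1)[OF x y]) (simp add: \<sigma>_def)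
  finally show "q (\<sigma> x \<cdot> \<sigma> y) = \<sigma> (q (x \<cdot> y))" .
qed

text \<open>Equivariance under both rotations, with \<open>\<sigma> = 2 * \<beta> - \<rho>\<close>,
  allows the outer rotation of \<open>q (x \<cdot> y)\<close> to be eliminated. Only values of one
  bilinear map with scalar coefficients remain.\<close>

lemma q_rot_split:
  assumes x: "H x" and y: "H y"
  shows "q (\<rho> x \<cdot> \<rho> y) = \<beta> *s (q (\<rho> x \<cdot> y) + q (x \<cdot> \<rho> y)) + (\<beta> - 2 * \<beta> * \<beta>) *s q (x \<cdot> y)"
proof (rule vec_eqI_scaled[OF two_neq_0])
  fix f assume f: "functional f"
  have "q (\<sigma> x \<cdot> \<sigma> y) = (2 * \<beta>) *s q (x \<cdot> y) - q (\<rho> x \<cdot> \<rho> y)"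
    by (simp only: q_rot[OF x y] \<sigma>_eq[OF Hq])
  then have "q (((2 * \<beta>) *s x - \<rho> x) \<cdot> ((2 * \<beta>) *s y - \<rho> y)) = (2 * \<beta>) *s q (x \<cdot> y) - q (\<rho> x \<cdot> \<rho> y)"
    by (simp only: \<sigma>_eq x y)
  from this[THEN eq_diff_0[where f=f]]
  show "2 * f (q (\<rho> x \<cdot> \<rho> y)) =
      2 * f (\<beta> *s (q (\<rho> x \<cdot> y) + q (x \<cdot> \<rho> y)) + (\<beta> - 2 * \<beta> * \<beta>) *s q (x \<cdot> y))"
    by (simp (no_asm_use) only: functional_simps[OF f] lin q_linear) algebra
qed

lemma q_rot_left:
  assumes x: "H x" and y: "H y"
  shows "q (\<rho> x \<cdot> y) = \<beta> *s q (x \<cdot> y)"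
proof (rule vec_eqI)
  fix f assume f: "functional f"
  define A B1 B2 C where "A = f (q (x \<cdot> y))" and "B1 = f (q (\<rho> x \<cdot> y))"
    and "B2 = f (q (x \<cdot> \<rho> y))" and "C = f (q (\<rho> x \<cdot> \<rho> y))"
  note abbr = A_def[symmetric] B1_def[symmetric] B2_def[symmetric] C_def[symmetric]
  have 1: "C = \<beta> * (B1 + B2) + (\<beta> - 2 * \<beta> * \<beta>) * A"
    using q_rot_split[OF x y, THEN arg_cong[where f=f]]
    by (simp only: functional_simps[OF f] abbr)
  have 2: "2 * \<beta> * C - B2 = \<beta> * (2 * \<beta> * B1 - A + C) + (\<beta> - 2 * \<beta> * \<beta>) * B1"
    using q_rot_split[OF H_rot(1)[OF x] y, THEN arg_cong[where f=f]]
    by (simp only: \<rho>_\<rho> x y lin q_linear functional_simps[OF f] abbr)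
  have 3: "2 * \<beta> * C - B1 = \<beta> * (C + (2 * \<beta> * B2 - A)) + (\<beta> - 2 * \<beta> * \<beta>) * B2"
    using q_rot_split[OF x H_rot(1)[OF y], THEN arg_cong[where f=f]]
    by (simp only: \<rho>_\<rho> x y lin q_linear functional_simps[OF f] abbr)
  \<comment> \<open>Subtracting the two relations obtained by rotating one argument gives
    \<open>(1 - \<beta>) * (B1 - B2) = 0\<close>.\<close>
  have "2 * (1 - \<alpha>) * (B1 - B2) = (2 * \<beta> * C - B2 - (2 * \<beta> * C - B1)) - \<beta> * (B1 - B2)"
    by algebra
  also have "\<dots> = 0" unfolding 2 3 by algebra
  finally have B2: "B2 = B1" using two_neq_0 by simp
  \<comment> \<open>Eliminating \<open>C\<close> leaves the factor
    \<open>1 + \<beta> - 2 * \<beta> * \<beta>\<close>, that is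
    \<open>(1 + 2 * \<beta>) * (1 - \<beta>)\<close>; its first factor is
    \<open>4 * \<alpha> - 1\<close>.\<close>
  have "(4 * \<alpha> - 1) * (2 * (1 - \<alpha>)) * (B1 - \<beta> * A) = 0"
    using 1 2 unfolding B2 by algebra
  then have "B1 = \<beta> * A" using form_ab_neq two_neq_0 by simp
  then show "f (q (\<rho> x \<cdot> y)) = f (\<beta> *s q (x \<cdot> y))"
    by (simp only: functional_simps[OF f] abbr)
qed

text \<open>Rotating the left argument twice multiplies by \<open>\<beta> * \<beta>\<close>, but by
  the quadratic equation of the rotation it multiplies by \<open>2 * \<beta> * \<beta> - 1\<close>.
  The two differ by \<open>1 - \<beta> * \<beta> = 4 * \<alpha> * (1 - \<alpha>)\<close>.\<close>

lemma q_H_H_zero: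
  assumes x: "H x" and y: "H y"
  shows "q (x \<cdot> y) = 0"
proof (rule vec_eqI_scaled[where k="4 * \<alpha> * (1 - \<alpha>)"])
  fix f assume f: "functional f"
  have "q (((2 * \<beta>) *s \<rho> x - x) \<cdot> y) = \<beta> *s (\<beta> *s q (x \<cdot> y))"
    using q_rot_left[OF H_rot(1)[OF x] y] by (simp only: \<rho>_\<rho> x q_rot_left y)
  then have "(2 * \<beta>) *s (\<beta> *s q (x \<cdot> y)) - q (x \<cdot> y) = \<beta> *s (\<beta> *s q (x \<cdot> y))"
    by (simp only: lin q_linear q_rot_left x y)
  from this[THEN eq_diff_0[where f=f]]
  show "4 * \<alpha> * (1 - \<alpha>) * f (q (x \<cdot> y)) = 4 * \<alpha> * (1 - \<alpha>) * f 0"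
    by (simp (no_asm_use) only: functional_simps[OF f]) algebra
qed (use form_ab_neq in simp)

section \<open>Relations between the two remaining components of products in H\<close>

lemma H_H_W0:
  assumes "H x" "H y"
  shows "W0 (x \<cdot> y - e \<cdot> (x \<cdot> y))" "e \<cdot> (e \<cdot> (x \<cdot> y)) = e \<cdot> (x \<cdot> y)"
proof -
  have *: "e \<cdot> (x \<cdot> y) - e \<cdot> (e \<cdot> (x \<cdot> y)) = 0"
    using q_H_H_zero[OF assms] by (simp only: q_def)
  then show "W0 (x \<cdot> y - e \<cdot> (x \<cdot> y))" by (simp only: W0_def mu_right)
  show "e \<cdot> (e \<cdot> (x \<cdot> y)) = e \<cdot> (x \<cdot> y)" using * by (metis eq_iff_diff_eq_0)
qed

text \<open>The part of \<open>G\<close> outside J lies in W1 and is killed by the plane, so only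
  the coordinates in J count, and the form reads them off.\<close>

lemma unit_space:
  assumes G: "e \<cdot> G = G"
  shows "2 *s (u \<cdot> G) = B e G *s u + B u G *s e" "2 *s (w \<cdot> G) = B e G *s w + B w G *s e"
proof -
  obtain r s t y where x: "G = r *s e + (s *s u + t *s w) + y" and y: "perp y" using plane_decomp by blast
  have "e \<cdot> G - G = e \<cdot> y - y" by (simp add: x plane_products e_idem)
  then have "e \<cdot> y = y" unfolding G by (metis diff_self eq_iff_diff_eq_0)
  then have yz: "u \<cdot> y = 0" "w \<cdot> y = 0" using W1_plane y by auto
  show "2 *s (u \<cdot> G) = B e G *s u + B u G *s e"
  proof (rule vec_eqI)
    fix f assume f: "functional f"
    show "f (2 *s (u \<cdot> G)) = f (B e G *s u + B u G *s e)"
      by (simp only: x lin plane_products plane_form form_axis_e yz perpD[OF y] functional_simps[OF f]) algebra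
  qed
  show "2 *s (w \<cdot> G) = B e G *s w + B w G *s e"
  proof (rule vec_eqI)
    fix f assume f: "functional f"
    show "f (2 *s (w \<cdot> G)) = f (B e G *s w + B w G *s e)"
      by (simp only: x lin plane_products plane_form form_axis_e yz perpD[OF y] functional_simps[OF f]) algebra
  qed
qed

lemma two_axis: "2 *s a = e + u" "2 *s b = e + w"
  by (simp_all add: u_def w_def)

lemma refl_half:
  assumes "2 *s c = e + v"
  shows "refl c y = y - 2 *s (e \<cdot> y + v \<cdot> y) + (B e y + B v y) *s (e + v)"
proof -
  have c: "2 *s (c \<cdot> y) = e \<cdot> y + v \<cdot> y" "2 * B c y = B e y + B v y"
    using arg_cong[OF assms, of "\<lambda>c. c \<cdot> y"] arg_cong[OF assms, of "\<lambda>c. B c y"] by simp_all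
  have "refl c y = y - 2 *s (2 *s (c \<cdot> y)) + (2 * B c y) *s (2 *s c)"
  proof (rule vec_eqI)
    fix f assume f: "functional f"
    show "f (refl c y) = f (y - 2 *s (2 *s (c \<cdot> y)) + (2 * B c y) *s (2 *s c))"
      by (simp only: functional_simps[OF f] refl_def) algebra
  qed
  then show ?thesis by (simp only: c assms)
qed

lemma refl_unit_space:
  assumes G: "e \<cdot> G = G"
  shows "refl a G = - G + B e G *s e + B u G *s u" "refl b G = - G + B e G *s e + B w G *s w"
proof -
  show "refl a G = - G + B e G *s e + B u G *s u"
  proof (rule vec_eqI)
    fix f assume f: "functional f"
    show "f (refl a G) = f (- G + B e G *s e + B u G *s u)"
      using unit_space(1)[OF G, THEN eq_diff_0[where f=f]]
      by (simp (no_asm_use) only: refl_half[OF two_axis(1)] G functional_simps[OF f]) algebra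
  qed
  show "refl b G = - G + B e G *s e + B w G *s w"
  proof (rule vec_eqI)
    fix f assume f: "functional f"
    show "f (refl b G) = f (- G + B e G *s e + B w G *s w)"
      using unit_space(2)[OF G, THEN eq_diff_0[where f=f]]
      by (simp (no_asm_use) only: refl_half[OF two_axis(2)] G functional_simps[OF f]) algebra
  qed
qed

lemma mu_e_refl: "e \<cdot> refl a g = refl a (e \<cdot> g)" "e \<cdot> refl b g = refl b (e \<cdot> g)"
proof -
  have "e \<cdot> a = a" "e \<cdot> b = b" using axis_mu_e commute by metis+
  then show "e \<cdot> refl a g = refl a (e \<cdot> g)" "e \<cdot> refl b g = refl b (e \<cdot> g)"
    by (simp_all add: refl_def mu_e_comm form_e_mu)
qed

lemma H_form_move:
  assumes x: "H x" and y: "H y"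
  shows "2 * B e (x \<cdot> y) = B x y" "4 * B u (x \<cdot> (u \<cdot> y)) = B x y" "4 * B w (x \<cdot> (w \<cdot> y)) = B x y"
proof -
  show "2 * B e (x \<cdot> y) = B x y"
    using x unfolding H_def by (metis form_assoc form_left(4))
  have "B u (x \<cdot> (u \<cdot> y)) = B x (u \<cdot> (u \<cdot> y))" "B w (x \<cdot> (w \<cdot> y)) = B x (w \<cdot> (w \<cdot> y))"
    by (metis form_assoc commute)+
  then show "4 * B u (x \<cdot> (u \<cdot> y)) = B x y" "4 * B w (x \<cdot> (w \<cdot> y)) = B x y"
    by (simp_all only: form_right(4)[symmetric] H_square[OF y])
qed

text \<open>\<open>H_H_move\<close> is not linear in the plane vector, since \<open>refl a\<close>
  contains a square of \<open>u\<close>. On its W0-component the involution is trivial, and the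
  relation becomes linear; \<open>H_H_unit\<close> does the same for the eigenvalue 1 of
  \<open>e\<close>.\<close>

lemma H_H_null:
  assumes x: "H x" and y: "H y"
  shows "(u \<cdot> x) \<cdot> y - e \<cdot> ((u \<cdot> x) \<cdot> y) = x \<cdot> (u \<cdot> y) - e \<cdot> (x \<cdot> (u \<cdot> y))"
    "(w \<cdot> x) \<cdot> y - e \<cdot> ((w \<cdot> x) \<cdot> y) = x \<cdot> (w \<cdot> y) - e \<cdot> (x \<cdot> (w \<cdot> y))"
proof -
  have r: "refl a z = z" "refl b z = z" if "W0 z" for z
    using W0_plane[OF that] perpD[OF W0_perp[OF that]] by (simp_all add: refl_def)
  show "(u \<cdot> x) \<cdot> y - e \<cdot> ((u \<cdot> x) \<cdot> y) = x \<cdot> (u \<cdot> y) - e \<cdot> (x \<cdot> (u \<cdot> y))"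
    by (simp only: H_H_move[OF x y] mu_e_refl refl_linear(2)[symmetric] r H_H_W0[OF x H_mu(1)[OF y]])
  show "(w \<cdot> x) \<cdot> y - e \<cdot> ((w \<cdot> x) \<cdot> y) = x \<cdot> (w \<cdot> y) - e \<cdot> (x \<cdot> (w \<cdot> y))"
    by (simp only: H_H_move[OF x y] mu_e_refl refl_linear(2)[symmetric] r H_H_W0[OF x H_mu(2)[OF y]])
qed

lemma H_H_unit:
  assumes x: "H x" and y: "H y"
  shows "4 *s (e \<cdot> ((u \<cdot> x) \<cdot> y) + e \<cdot> (x \<cdot> (u \<cdot> y))) = (2 * B x (u \<cdot> y)) *s e + B x y *s u"
    "4 *s (e \<cdot> ((w \<cdot> x) \<cdot> y) + e \<cdot> (x \<cdot> (w \<cdot> y))) = (2 * B x (w \<cdot> y)) *s e + B x y *s w"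
proof -
  have "4 *s (e \<cdot> ((u \<cdot> x) \<cdot> y) + e \<cdot> (x \<cdot> (u \<cdot> y))) =
      (2 * (2 * B e (x \<cdot> (u \<cdot> y)))) *s e + (4 * B u (x \<cdot> (u \<cdot> y))) *s u"
    by (simp only: H_H_move[OF x y] mu_e_refl refl_unit_space H_H_W0[OF x H_mu(1)[OF y]] form_e_mu)
      (rule vec_eqI', simp add: ring_distribs)
  then show "4 *s (e \<cdot> ((u \<cdot> x) \<cdot> y) + e \<cdot> (x \<cdot> (u \<cdot> y))) = (2 * B x (u \<cdot> y)) *s e + B x y *s u"
    by (simp only: H_form_move[OF x y] H_form_move[OF x H_mu(1)[OF y]])
  have "4 *s (e \<cdot> ((w \<cdot> x) \<cdot> y) + e \<cdot> (x \<cdot> (w \<cdot> y))) =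
      (2 * (2 * B e (x \<cdot> (w \<cdot> y)))) *s e + (4 * B w (x \<cdot> (w \<cdot> y))) *s w"
    by (simp only: H_H_move[OF x y] mu_e_refl refl_unit_space H_H_W0[OF x H_mu(2)[OF y]] form_e_mu)
      (rule vec_eqI', simp add: ring_distribs)
  then show "4 *s (e \<cdot> ((w \<cdot> x) \<cdot> y) + e \<cdot> (x \<cdot> (w \<cdot> y))) = (2 * B x (w \<cdot> y)) *s e + B x y *s w"
    by (simp only: H_form_move[OF x y] H_form_move[OF x H_mu(2)[OF y]])
qed

subsection \<open>Every nontrivial idempotent of J\<close>

lemma component_induct [case_names add scale e u w W1 W0 H]:
  assumes "\<And>x y. P x \<Longrightarrow> P y \<Longrightarrow> P (x + y)" "\<And>k x. P x \<Longrightarrow> P (k *s x)"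
    and "P e" "P u" "P w" "\<And>x. W1 x \<Longrightarrow> P x" "\<And>x. W0 x \<Longrightarrow> P x" "\<And>x. H x \<Longrightarrow> P x"
  shows "P x"
proof -
  obtain r s t y1 y0 h where "x = r *s e + (s *s u + t *s w) + y1 + y0 + h"
    and "W1 y1" "W0 y0" "H h"
    using decomp by blast
  then show ?thesis using assms by simp
qed

context
  fixes s t :: 'k and v c :: 'a
  assumes v: "v = s *s u + t *s w"
    and norm: "s * s + t * t + 2 * \<beta> * s * t = 1"
    and c: "2 *s c = e + v"
begin

private lemma v_plane:
  "v \<cdot> u = (s + \<beta> * t) *s e" "v \<cdot> w = (\<beta> * s + t) *s e"
  "u \<cdot> v = (s + \<beta> * t) *s e" "w \<cdot> v = (\<beta> * s + t) *s e"
  "v \<cdot> e = v" "e \<cdot> v = v" "v \<cdot> v = e"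
  "B v u = 2 * (s + \<beta> * t)" "B v w = 2 * (\<beta> * s + t)" "B v e = 0" "B e v = 0" "B v v = 2"
proof -
  show 1: "v \<cdot> u = (s + \<beta> * t) *s e" "v \<cdot> w = (\<beta> * s + t) *s e"
    unfolding v lin plane_products scale_scale scale_left_distrib[symmetric]
    by (rule arg_cong[where f="\<lambda>r. r *s e"]; algebra)+
  then show "u \<cdot> v = (s + \<beta> * t) *s e" "w \<cdot> v = (\<beta> * s + t) *s e"
    by (simp_all only: commute[of _ v])
  show "v \<cdot> e = v" "e \<cdot> v = v"
    by (simp_all add: v plane_products)
  show "v \<cdot> v = e"
  proof (rule vec_eqI)
    fix f assume f: "functional f"
    have "f (v \<cdot> v) = (s * s + t * t + 2 * \<beta> * s * t) * f e"
      by (simp only: v lin plane_products functional_simps[OF f]) algebra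
    then show "f (v \<cdot> v) = f e" by (simp only: norm mult_1_left)
  qed
  show "B v u = 2 * (s + \<beta> * t)" "B v w = 2 * (\<beta> * s + t)" "B v e = 0" "B e v = 0"
    unfolding v lin plane_form by algebra+
  have "B v v = 2 * (s * s + t * t + 2 * \<beta> * s * t)"
    unfolding v lin plane_form by algebra
  then show "B v v = 2" by (simp only: norm mult_1_right)
qed

private lemma v_H:
  assumes h: "H h"
  shows "H (v \<cdot> h)" "4 *s (v \<cdot> (v \<cdot> h)) = h"
    "2 *s (v \<cdot> (u \<cdot> h) + u \<cdot> (v \<cdot> h)) = (s + \<beta> * t) *s h"
    "2 *s (v \<cdot> (w \<cdot> h) + w \<cdot> (v \<cdot> h)) = (\<beta> * s + t) *s h"
proof -
  show "H (v \<cdot> h)" unfolding v lin by (intro comp_linear H_mu h)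
  note sq = H_square[OF h]
  show "4 *s (v \<cdot> (v \<cdot> h)) = h"
  proof (rule vec_eqI)
    fix f assume f: "functional f"
    have "4 * f (v \<cdot> (v \<cdot> h)) = (s * s + t * t + 2 * \<beta> * s * t) * f h"
      using sq[THEN eq_diff_0[where f=f]]
      by (simp (no_asm_use) only: v lin functional_simps[OF f]) algebra
    then show "f (4 *s (v \<cdot> (v \<cdot> h))) = f h"
      by (simp only: functional_simps[OF f] norm mult_1_left)
  qed
  show "2 *s (v \<cdot> (u \<cdot> h) + u \<cdot> (v \<cdot> h)) = (s + \<beta> * t) *s h"
  proof (rule vec_eqI)
    fix f assume f: "functional f"
    show "f (2 *s (v \<cdot> (u \<cdot> h) + u \<cdot> (v \<cdot> h))) = f ((s + \<beta> * t) *s h)"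
      using sq[THEN eq_diff_0[where f=f]]
      by (simp (no_asm_use) only: v lin functional_simps[OF f]) algebra
  qed
  show "2 *s (v \<cdot> (w \<cdot> h) + w \<cdot> (v \<cdot> h)) = (\<beta> * s + t) *s h"
  proof (rule vec_eqI)
    fix f assume f: "functional f"
    show "f (2 *s (v \<cdot> (w \<cdot> h) + w \<cdot> (v \<cdot> h))) = f ((\<beta> * s + t) *s h)"
      using sq[THEN eq_diff_0[where f=f]]
      by (simp (no_asm_use) only: v lin functional_simps[OF f]) algebra
  qed
qed

private lemma v_W: "W1 y \<Longrightarrow> v \<cdot> y = 0" "W0 y \<Longrightarrow> v \<cdot> y = 0" "perp y \<Longrightarrow> B v y = 0"
  using W1_axis W0_plane perpD by (simp_all add: v)

private lemma v_e: "v \<cdot> (e \<cdot> y) = e \<cdot> (v \<cdot> y)" "B v (e \<cdot> y) = B v y"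
  by (simp_all add: v mu_e_comm_plane form_e_mu)

private lemma refl_c: "refl c y = y - 2 *s (e \<cdot> y + v \<cdot> y) + (B e y + B v y) *s (e + v)"
  by (rule refl_half[OF c])

private lemma refl_components:
  "refl c e = e" "refl c u = (2 * (s + \<beta> * t)) *s v - u" "refl c w = (2 * (\<beta> * s + t)) *s v - w"
  "W1 y \<Longrightarrow> refl c y = - y" "W0 y \<Longrightarrow> refl c y = y" "H y \<Longrightarrow> refl c y = (-2) *s (v \<cdot> y)"
proof -
  show "refl c e = e"
    unfolding refl_c by (simp add: e_idem v_plane form_axis_e)
  show "refl c u = (2 * (s + \<beta> * t)) *s v - u"
  proof (rule vec_eqI)
    fix f assume f: "functional f"
    show "f (refl c u) = f ((2 * (s + \<beta> * t)) *s v - u)"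
      by (simp only: refl_c plane_products plane_form v_plane functional_simps[OF f]) algebra
  qed
  show "refl c w = (2 * (\<beta> * s + t)) *s v - w"
  proof (rule vec_eqI)
    fix f assume f: "functional f"
    show "f (refl c w) = f ((2 * (\<beta> * s + t)) *s v - w)"
      by (simp only: refl_c plane_products plane_form v_plane functional_simps[OF f]) algebra
  qed
  show "refl c y = - y" if "W1 y"
  proof (rule vec_eqI)
    fix f assume f: "functional f"
    note W1_axis(5,6)[OF that]
    then show "f (refl c y) = f (- y)"
      by (simp add: refl_c v_W that perpD functional_simps[OF f])
  qed
  show "refl c y = y" if "W0 y"
    using that W0_perp[OF that] by (simp add: refl_c v_W perpD) (simp add: W0_def)
  show "refl c y = (-2) *s (v \<cdot> y)" if "H y"
  proof (rule vec_eqI)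
    fix f assume f: "functional f"
    show "f (refl c y) = f ((-2) *s (v \<cdot> y))"
      using that[unfolded H_def, THEN eq_diff_0[where f=f]]
      by (simp (no_asm_use) only: refl_c v_W perpD H_perp[OF that] functional_simps[OF f]) algebra
  qed
qed

section \<open>Multiplicativity of the involution of a general idempotent, checked on pairs of
  components\<close>

private definition T :: "'a \<Rightarrow> 'a \<Rightarrow> bool" where
  "T x y \<longleftrightarrow> refl c (x \<cdot> y) = refl c x \<cdot> refl c y"

private lemma T_sym: "T x y \<Longrightarrow> T y x"
  by (simp only: T_def commute)

private lemma T_linear: "T x y \<Longrightarrow> T x z \<Longrightarrow> T x (y + z)" "T x y \<Longrightarrow> T x (k *s y)"
  by (simp_all add: T_def)

private lemma T_e: "T e y"
proof -
  have "refl c (e \<cdot> y) = e \<cdot> refl c y"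
    by (simp add: refl_c v_e v_plane e_idem form_e_mu)
  then show ?thesis by (simp only: T_def refl_components)
qed

text \<open>On W1 and W0 both sides vanish because the plane acts as zero there; on H the claim is
  the Clifford relation between \<open>v\<close> and \<open>u\<close>.\<close>

private lemma T_u: "T u y"
proof (induction y rule: component_induct)
  case u
  show ?case unfolding T_def
  proof (rule vec_eqI)
    fix f assume f: "functional f"
    show "f (refl c (u \<cdot> u)) = f (refl c u \<cdot> refl c u)"
      by (simp only: plane_products v_plane refl_components lin functional_simps[OF f]) algebra
  qed
next
  case w
  show ?case unfolding T_def
  proof (rule vec_eqI)
    fix f assume f: "functional f"
    show "f (refl c (u \<cdot> w)) = f (refl c u \<cdot> refl c w)"
      by (simp only: plane_products v_plane refl_components refl_linear lin functional_simps[OF f]) algebra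
  qed
next
  case (W1 y)
  then show ?case by (simp add: T_def refl_components W1_axis v_W) (simp add: refl_c)
next
  case (W0 y)
  then show ?case by (simp add: T_def refl_components W0_plane v_W) (simp add: refl_c)
next
  case (H h)
  show ?case unfolding T_def
  proof (rule vec_eqI_scaled[OF two_neq_0])
    fix f assume f: "functional f"
    show "2 * f (refl c (u \<cdot> h)) = 2 * f (refl c u \<cdot> refl c h)"
      using v_H(2,3)[OF H, THEN eq_diff_0[where f=f]]
      by (simp (no_asm_use) only: refl_components H H_mu lin functional_simps[OF f]) algebra
  qed
qed (use T_linear T_sym[OF T_e] in auto)

private lemma T_w: "T w y"
proof (induction y rule: component_induct)
  case w
  show ?case unfolding T_def
  proof (rule vec_eqI)
    fix f assume f: "functional f"
    show "f (refl c (w \<cdot> w)) = f (refl c w \<cdot> refl c w)"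
      by (simp only: plane_products v_plane refl_components lin functional_simps[OF f]) algebra
  qed
next
  case (W1 y)
  then show ?case by (simp add: T_def refl_components W1_axis v_W) (simp add: refl_c)
next
  case (W0 y)
  then show ?case by (simp add: T_def refl_components W0_plane v_W) (simp add: refl_c)
next
  case (H h)
  show ?case unfolding T_def
  proof (rule vec_eqI_scaled[OF two_neq_0])
    fix f assume f: "functional f"
    show "2 * f (refl c (w \<cdot> h)) = 2 * f (refl c w \<cdot> refl c h)"
      using v_H(2,4)[OF H, THEN eq_diff_0[where f=f]]
      by (simp (no_asm_use) only: refl_components H H_mu lin functional_simps[OF f]) algebra
  qed
qed (use T_linear T_sym[OF T_e] T_sym[OF T_u] in auto)

private lemma T_W0:
  assumes z: "W0 z"
  shows "T z y"
proof (induction y rule: component_induct)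
  case (W1 y)
  then show ?case
    by (simp add: T_def refl_components z W0_W1[OF z W1])
next
  case (W0 y)
  then show ?case
    by (simp add: T_def refl_components z W0_W0[OF z W0])
next
  case (H h)
  have "v \<cdot> (z \<cdot> h) = z \<cdot> (v \<cdot> h)"
    by (simp add: v W0_H(2,3)[OF z H])
  then show ?case
    by (simp add: T_def refl_components H z W0_H(1)[OF z H])
qed (use T_linear T_sym[OF T_e] T_sym[OF T_u] T_sym[OF T_w] in auto)

private lemma T_W1:
  assumes x: "W1 x"
  shows "T x y"
proof (induction y rule: component_induct)
  case (W1 y)
  have "2 *s refl c (x \<cdot> y) = refl c ((2 *s (x \<cdot> y) - B x y *s e) + B x y *s e)"
    by simp
  also have "\<dots> = 2 *s (x \<cdot> y)"
    unfolding refl_linear(1,4) refl_components(1) refl_components(5)[OF W1_W1[OF x W1]] by simp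
  finally show ?case
    using two_cancel by (simp add: T_def refl_components x W1)
next
  case (H h)
  have "v \<cdot> (x \<cdot> h) = - (x \<cdot> (v \<cdot> h))"
    by (simp add: v W1_H(2,3)[OF x H])
  then show ?case
    by (simp add: T_def refl_components H x W1_H(1)[OF x H])
qed (use T_linear T_sym[OF T_e] T_sym[OF T_u] T_sym[OF T_w] T_sym[OF T_W0] in auto)

text \<open>The two linear relations for products in H extend from \<open>u\<close>,
  \<open>w\<close> to \<open>v\<close>. The components of the product for the eigenvalues 0 and 1 of
  \<open>e\<close> are then compared separately, in facts 1 and 2; fact 3 evaluates the action of
  \<open>v\<close> in \<open>refl c\<close>.\<close>

private lemma refl_H_H:
  assumes x: "H x" and y: "H y"
  shows "refl c (x \<cdot> y) = 4 *s ((v \<cdot> x) \<cdot> (v \<cdot> y))"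
proof (rule vec_eqI_scaled[OF two_neq_0])
  fix f assume f: "functional f"
  \<comment> \<open>As \<open>y = 4 *s (v \<cdot> z)\<close>, moving \<open>v\<close> from one
    factor to the other relates the product of \<open>v \<cdot> x\<close> and
    \<open>v \<cdot> y\<close> to that of \<open>x\<close> and \<open>y\<close>.\<close>
  define z where "z = v \<cdot> y"
  have z: "H z" and vz: "4 *s (v \<cdot> z) = y"
    unfolding z_def using v_H[OF y] by auto
  have null: "(v \<cdot> x) \<cdot> z - e \<cdot> ((v \<cdot> x) \<cdot> z) = x \<cdot> (v \<cdot> z) - e \<cdot> (x \<cdot> (v \<cdot> z))"
  proof (rule vec_eqI)
    fix f assume f: "functional f"
    show "f ((v \<cdot> x) \<cdot> z - e \<cdot> ((v \<cdot> x) \<cdot> z)) = f (x \<cdot> (v \<cdot> z) - e \<cdot> (x \<cdot> (v \<cdot> z)))"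
      using H_H_null[OF x z, THEN eq_diff_0[where f=f]]
      by (simp (no_asm_use) only: v lin functional_simps[OF f]) algebra
  qed
  have unit: "4 *s (e \<cdot> ((v \<cdot> x) \<cdot> z) + e \<cdot> (x \<cdot> (v \<cdot> z))) = (2 * B x (v \<cdot> z)) *s e + B x z *s v"
  proof (rule vec_eqI)
    fix f assume f: "functional f"
    show "f (4 *s (e \<cdot> ((v \<cdot> x) \<cdot> z) + e \<cdot> (x \<cdot> (v \<cdot> z)))) = f ((2 * B x (v \<cdot> z)) *s e + B x z *s v)"
      using H_H_unit[OF x z, THEN eq_diff_0[where f=f]]
      by (simp (no_asm_use) only: v lin functional_simps[OF f]) algebra
  qed
  have 1: "4 *s ((v \<cdot> x) \<cdot> z - e \<cdot> ((v \<cdot> x) \<cdot> z)) = x \<cdot> y - e \<cdot> (x \<cdot> y)"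
    unfolding null by (simp only: vz[symmetric] mu_right scale_right_diff_distrib)
  have 2: "8 *s (e \<cdot> ((v \<cdot> x) \<cdot> z)) + 2 *s (e \<cdot> (x \<cdot> y)) = B x y *s e + (2 * B x z) *s v"
  proof (rule vec_eqI)
    fix f assume f: "functional f"
    show "f (8 *s (e \<cdot> ((v \<cdot> x) \<cdot> z)) + 2 *s (e \<cdot> (x \<cdot> y))) = f (B x y *s e + (2 * B x z) *s v)"
      using unit[THEN eq_diff_0[where f=f]]
      by (simp (no_asm_use) only: vz[symmetric] lin functional_simps[OF f]) algebra
  qed
  have "B v (x \<cdot> y) = B x z"
    unfolding z_def by (metis form_assoc commute)
  note form = this H_form_move(1)[OF x y]
  have "v \<cdot> (x \<cdot> y - e \<cdot> (x \<cdot> y)) = 0"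
    by (rule v_W(2)[OF H_H_W0(1)[OF x y]])
  then have vg: "v \<cdot> (x \<cdot> y) = v \<cdot> (e \<cdot> (x \<cdot> y))" by simp
  have "2 *s (v \<cdot> (e \<cdot> (x \<cdot> y))) = B e (x \<cdot> y) *s v + B v (x \<cdot> y) *s e"
  proof (rule vec_eqI)
    fix f assume f: "functional f"
    show "f (2 *s (v \<cdot> (e \<cdot> (x \<cdot> y)))) = f (B e (x \<cdot> y) *s v + B v (x \<cdot> y) *s e)"
      using unit_space[OF H_H_W0(2)[OF x y], THEN eq_diff_0[where f=f]]
      by (simp (no_asm_use) only: v form_e_mu lin functional_simps[OF f]) algebra
  qed
  then have 3: "2 *s (v \<cdot> (x \<cdot> y)) = B e (x \<cdot> y) *s v + B x z *s e"
    by (simp only: vg form)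
  show "2 * f (refl c (x \<cdot> y)) = 2 * f (4 *s ((v \<cdot> x) \<cdot> (v \<cdot> y)))"
    using 1[THEN eq_diff_0[where f=f]] 2[THEN eq_diff_0[where f=f]] 3[THEN eq_diff_0[where f=f]]
      form(2)[THEN eq_diff_0[where f="\<lambda>k. k"]]
    by (simp (no_asm_use) only: refl_c form(1) z_def[symmetric] lin functional_simps[OF f]) algebra
qed

private lemma T_H:
  assumes x: "H x"
  shows "T x y"
proof (induction y rule: component_induct)
  case (H y)
  then show ?case by (simp add: T_def refl_H_H refl_components x)
qed (use T_linear T_sym[OF T_e] T_sym[OF T_u] T_sym[OF T_w] T_sym[OF T_W0] T_sym[OF T_W1] x in auto)

lemma refl_mult: "refl c (x \<cdot> y) = refl c x \<cdot> refl c y"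
proof -
  have "T y x"
    by (induction x rule: component_induct)
      (use T_linear T_sym[OF T_e] T_sym[OF T_u] T_sym[OF T_w] T_sym[OF T_W0] T_sym[OF T_W1] T_sym[OF T_H] in auto)
  then show ?thesis using T_sym by (simp only: T_def)
qed

private lemma half_act: "2 *s (c \<cdot> y) = e \<cdot> y + v \<cdot> y" "2 * B c y = B e y + B v y"
  using arg_cong[OF c, of "\<lambda>c. c \<cdot> y"] arg_cong[OF c, of "\<lambda>c. B c y"] by simp_all

text \<open>This is the quadratic axis identity for \<open>c\<close>, cleared of denominators so
  that \<open>e\<close> and \<open>v\<close> act separately on each component.\<close>

private lemma c_square:
  "2 *s ((e + v) \<cdot> ((e + v) \<cdot> y)) = 2 *s ((e + v) \<cdot> y) + (B e y + B v y) *s (e + v)"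
proof (induction y rule: component_induct)
  case (add x y)
  show ?case
  proof (rule vec_eqI)
    fix f assume f: "functional f"
    show "f (2 *s ((e + v) \<cdot> ((e + v) \<cdot> (x + y)))) =
        f (2 *s ((e + v) \<cdot> (x + y)) + (B e (x + y) + B v (x + y)) *s (e + v))"
      using add[THEN eq_diff_0[where f=f]]
      by (simp (no_asm_use) only: lin functional_simps[OF f]) algebra
  qed
next
  case (scale k x)
  show ?case
  proof (rule vec_eqI)
    fix f assume f: "functional f"
    show "f (2 *s ((e + v) \<cdot> ((e + v) \<cdot> (k *s x)))) =
        f (2 *s ((e + v) \<cdot> (k *s x)) + (B e (k *s x) + B v (k *s x)) *s (e + v))"
      using scale[THEN eq_diff_0[where f=f]]
      by (simp (no_asm_use) only: lin functional_simps[OF f]) algebra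
  qed
next
  case e
  show ?case
  proof (rule vec_eqI)
    fix f assume f: "functional f"
    show "f (2 *s ((e + v) \<cdot> ((e + v) \<cdot> e))) = f (2 *s ((e + v) \<cdot> e) + (B e e + B v e) *s (e + v))"
      by (simp only: lin e_idem v_plane form_axis_e functional_simps[OF f]) algebra
  qed
next
  case u
  show ?case
  proof (rule vec_eqI)
    fix f assume f: "functional f"
    show "f (2 *s ((e + v) \<cdot> ((e + v) \<cdot> u))) = f (2 *s ((e + v) \<cdot> u) + (B e u + B v u) *s (e + v))"
      by (simp only: lin e_idem plane_products v_plane plane_form functional_simps[OF f]) algebra
  qed
next
  case w
  show ?case
  proof (rule vec_eqI)
    fix f assume f: "functional f"
    show "f (2 *s ((e + v) \<cdot> ((e + v) \<cdot> w))) = f (2 *s ((e + v) \<cdot> w) + (B e w + B v w) *s (e + v))"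
      by (simp only: lin e_idem plane_products v_plane plane_form functional_simps[OF f]) algebra
  qed
next
  case (W1 y)
  then show ?case using W1_axis(5,6)[OF W1] by (simp add: v_W perpD)
next
  case (W0 y)
  then show ?case using W0_perp[OF W0] by (simp add: v_W perpD) (simp add: W0_def)
next
  case (H h)
  show ?case
  proof (rule vec_eqI_scaled[OF four_neq_0])
    fix f assume f: "functional f"
    have 1: "2 *s (e \<cdot> (v \<cdot> h)) = v \<cdot> h" using v_H(1)[OF H] by (simp only: H_def)
    have 2: "2 *s (e \<cdot> h) = h" using H by (simp only: H_def)
    have 3: "2 *s (e \<cdot> (e \<cdot> h)) = e \<cdot> h" using 2 mu_right(4) by metis
    show "4 * f (2 *s ((e + v) \<cdot> ((e + v) \<cdot> h))) =
        4 * f (2 *s ((e + v) \<cdot> h) + (B e h + B v h) *s (e + v))"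
      using v_H(2)[OF H, THEN eq_diff_0[where f=f]] 1[THEN eq_diff_0[where f=f]]
        2[THEN eq_diff_0[where f=f]] 3[THEN eq_diff_0[where f=f]]
      by (simp (no_asm_use) only: lin v_e v_W(3) perpD H_perp[OF H] functional_simps[OF f]) algebra
  qed
qed

lemma axis_identities_half: "axis_identities c"
  unfolding axis_identities_def
proof (intro conjI allI)
  show "c \<noteq> 0"
  proof
    assume "c = 0"
    then have "B e (e + v) = 0" using c by (metis form_right(5) scale_zero_right)
    then show False using two_neq_0 by (simp add: form_axis_e v_plane)
  qed
  have "4 *s (c \<cdot> c) = (2 *s c) \<cdot> (2 *s c)" by simp
  also have "\<dots> = 2 *s (2 *s c)"
    unfolding c by (rule vec_eqI') (simp add: e_idem v_plane)
  also have "\<dots> = 4 *s c" by simp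
  finally show "c \<cdot> c = c" by simp
  show "2 *s (c \<cdot> (c \<cdot> y)) = c \<cdot> y + B c y *s c" for y
  proof (rule vec_eqI_scaled[OF four_neq_0])
    fix f assume f: "functional f"
    have "2 *s ((2 *s c) \<cdot> ((2 *s c) \<cdot> y)) = 2 *s ((2 *s c) \<cdot> y) + (2 * B c y) *s (2 *s c)"
      unfolding c half_act by (rule c_square)
    from this[THEN eq_diff_0[where f=f]]
    show "4 * f (2 *s (c \<cdot> (c \<cdot> y))) = 4 * f (c \<cdot> y + B c y *s c)"
      by (simp (no_asm_use) only: lin functional_simps[OF f]) algebra
  qed
  show "refl c (x \<cdot> y) = refl c x \<cdot> refl c y" for x y
    by (rule refl_mult)
qed

end

section \<open>The idempotents of J\<close>

lemma gen_subalg_span: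
  assumes "x \<in> gen_subalg sc mu {a, b}"
  shows "\<exists>r s t. x = r *s e + (s *s u + t *s w)"
  using assms
proof induction
  case (gen_base x)
  have "2 *s a = 2 *s ((1/2) *s e + ((1/2) *s u + 0 *s w))"
    "2 *s b = 2 *s ((1/2) *s e + (0 *s u + (1/2) *s w))"
    using two_neq_0 by (simp_all add: two_axis scale_right_distrib)
  then have "a = (1/2) *s e + ((1/2) *s u + 0 *s w)" "b = (1/2) *s e + (0 *s u + (1/2) *s w)"
    using two_cancel by blast+
  with gen_base show ?case by blast
next
  case gen_zero
  have "0 = 0 *s e + (0 *s u + 0 *s w)" by simp
  then show ?case by blast
next
  case (gen_add x y)
  then obtain r s t r' s' t' where "x = r *s e + (s *s u + t *s w)" "y = r' *s e + (s' *s u + t' *s w)"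
    by blast
  then have "x + y = (r + r') *s e + ((s + s') *s u + (t + t') *s w)"
    by (simp add: scale_left_distrib)
  then show ?case by blast
next
  case (gen_scale x k)
  then obtain r s t where "x = r *s e + (s *s u + t *s w)" by blast
  then have "k *s x = (k * r) *s e + ((k * s) *s u + (k * t) *s w)"
    by (simp add: scale_right_distrib)
  then show ?case by blast
next
  case (gen_mult x y)
  then obtain r s t r' s' t' where xy: "x = r *s e + (s *s u + t *s w)" "y = r' *s e + (s' *s u + t' *s w)"
    by blast
  have "x \<cdot> y = (r * r' + s * s' + t * t' + \<beta> * (s * t' + t * s')) *s e
      + ((r * s' + s * r') *s u + (r * t' + t * r') *s w)"
  proof (rule vec_eqI)
    fix f assume f: "functional f"
    show "f (x \<cdot> y) = f ((r * r' + s * s' + t * t' + \<beta> * (s * t' + t * s')) *s e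
      + ((r * s' + s * r') *s u + (r * t' + t * r') *s w))"
      by (simp only: xy lin e_idem plane_products functional_simps[OF f]) algebra
  qed
  then show ?case by blast
qed

lemma e_identity: "is_identity_of mu (gen_subalg sc mu {a, b}) e"
  unfolding is_identity_of_def
proof (intro conjI ballI)
  have "e = (1 / (\<alpha> - 1)) *s (2 *s (a \<cdot> b) + (-1) *s (a + b))"
    by (simp add: e_def algebra_simps)
  also have "\<dots> \<in> gen_subalg sc mu {a, b}"
    by (intro gen_subalg.intros) auto
  finally show "e \<in> gen_subalg sc mu {a, b}" .
  fix x assume "x \<in> gen_subalg sc mu {a, b}"
  then obtain r s t where "x = r *s e + (s *s u + t *s w)" using gen_subalg_span by blast
  then show "e \<cdot> x = x" by (simp add: e_idem plane_products)
qed

text \<open>Pairing \<open>c \<cdot> c - c\<close> with \<open>e\<close>, which is orthogonal to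
  \<open>v\<close>, isolates the coefficient of \<open>e\<close>, so coefficients are compared
  without proving independence. The remaining term forces \<open>v = 0\<close>, giving 0 or
  \<open>e\<close>, or \<open>r\<close> equal to 1/2 and norm 1/4; doubling then gives the
  normalised \<open>v\<close>.\<close>

lemma idempotent_axis_identities:
  assumes c: "c \<in> gen_subalg sc mu {a, b}" "c \<cdot> c = c" "c \<noteq> 0" "c \<noteq> e"
  shows "axis_identities c"
proof -
  obtain r s t where rst: "c = r *s e + (s *s u + t *s w)" using gen_subalg_span c(1) by blast
  define v where "v = s *s u + t *s w"
  define n where "n = s * s + t * t + 2 * \<beta> * s * t"
  have cc: "(r * r + n - r) *s e + (2 * r - 1) *s v = 0"
  proof (rule vec_eqI)
    fix f assume f: "functional f"
    show "f ((r * r + n - r) *s e + (2 * r - 1) *s v) = f 0"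
      using c(2)[THEN eq_diff_0[where f=f]]
      by (simp (no_asm_use) only: rst n_def v_def lin e_idem plane_products functional_simps[OF f]) algebra
  qed
  have "B e v = 0" "B v v = 2 * n" "B v e = 0"
    unfolding v_def n_def lin plane_form by algebra+
  then have "B e ((r * r + n - r) *s e + (2 * r - 1) *s v) = 2 * (r * r + n - r)"
    by (simp add: form_axis_e mult.commute)
  then have "2 * (r * r + n - r) = 0" by (simp only: cc lin)
  then have rn: "r * r + n - r = 0" using two_neq_0 by (metis mult_eq_0_iff)
  with cc have "2 * r - 1 = 0 \<or> v = 0" by simp
  then show ?thesis
  proof
    assume "v = 0"
    with \<open>B v v = 2 * n\<close> have "n = 0" using two_neq_0 by simp
    with rn have "r * (r - 1) = 0" by algebra
    then have "c = 0 \<or> c = e" using rst \<open>v = 0\<close> by (auto simp: v_def)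
    with c show ?thesis by blast
  next
    assume r: "2 * r - 1 = 0"
    show ?thesis
    proof (rule axis_identities_half)
      have "4 * n = 1" using rn r by algebra
      then show "(2 * s) * (2 * s) + (2 * t) * (2 * t) + 2 * \<beta> * (2 * s) * (2 * t) = 1"
        unfolding n_def by algebra
      have "2 * r = 1" using r by simp
      then show "2 *s c = e + ((2 * s) *s u + (2 * t) *s w)"
        by (simp add: rst scale_right_distrib)
    qed (rule refl)
  qed
qed

end

theorem theorem1:
  fixes sc :: "'k::field \<Rightarrow> 'a::ab_group_add \<Rightarrow> 'a"
    and mu :: "'a \<Rightarrow> 'a \<Rightarrow> 'a"
    and B :: "'a \<Rightarrow> 'a \<Rightarrow> 'k"
    and a b :: 'a
  assumes "(2::'k) \<noteq> 0"
    and "jordan_type_half_algebra sc mu"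
    and "frobenius_form sc mu B"
    and "prim_axis_half sc mu a"
    and "prim_axis_half sc mu b"
    and "B a b \<notin> {0, 1/4, 1}"
  shows "solid sc mu a b"
proof -
  interpret form_algebra sc mu B
    using assms by unfold_locales (auto simp: jordan_type_half_algebra_def)
  have "4 * B a b \<noteq> 1"
    using assms(6) four_neq_0 by (auto simp: eq_divide_eq mult.commute)
  then interpret axis_pair sc mu B a b
    using assms prim_axis_halfD by unfold_locales auto
  show ?thesis
    unfolding solid_def
    using idempotent_axis_identities prim_axis_halfI e_identity by metis
qed

end
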